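(* Let $p_1,p_2\in\mathbb{R}[x]$ be nonzero polynomials. If $\mathscr{W}(p_1)\in \mathrm{ULC}(\deg p_1)$ and $\mathscr{W}(p_2)\in \mathrm{ULC}(\deg p_2)$, then $\mathscr{W}(p_1p_2)\in \mathrm{ULC}(\deg p_1+\deg p_2)$.
   Context: For a polynomial $p\in\mathbb{R}[x]$ of degree $d$, $\mathscr{W}(p)\in\mathbb{R}[x]$ denotes the polynomial (of degree at most $d$) defined by $\sum_{j\ge 0} p(j)x^j = \mathscr{W}(p)(x)/(1-x)^{d+1}$; equivalently, $\mathscr{W}(p)=\sum_{i=0}^d h_ix^i$ where $p(x)=\sum_{i=0}^d h_i\binom{x+d-i}{d}$. For an integer $m$, $\mathrm{ULC}(m)$ denotes the set of polynomials $a(x)=\sum_{j=0}^{e} a_jx^j$ with nonnegative coefficients, $e\le m$, such that the sequence $\big(a_j/\binom{m}{j}\big)_{j=0}^{e}$ is log-concave (i.e. $c_j^2\ge c_{j-1}c_{j+1}$ for all interior $j$) and $a$ has no internal zeros (there are no indices $i<j<k$ with $a_j=0$ and $a_ia_k\neq 0$). *)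

theory Defs
  imports Complex_Main "HOL-Computational_Algebra.Computational_Algebra"
begin

definition values_fps :: "real poly \<Rightarrow> real fps" where
  "values_fps p = Abs_fps (\<lambda>j. poly p (of_nat j))"

text \<open>Existence and uniqueness of the polynomial described here are shown below in
  \<open>values_fps_eq_W_poly\<close> and \<open>W_poly_unique\<close>.\<close>

definition W_poly :: "real poly \<Rightarrow> real poly" where
  "W_poly p = (THE w. values_fps p = fps_of_poly w / (1 - fps_X) ^ (degree p + 1))"

definition log_concave_upto :: "nat \<Rightarrow> (nat \<Rightarrow> real) \<Rightarrow> bool" where
  "log_concave_upto e c \<longleftrightarrow> (\<forall>j. 0 < j \<and> j < e \<longrightarrow> (c j)\<^sup>2 \<ge> c (j - 1) * c (j + 1))"

definition no_internal_zeros :: "real poly \<Rightarrow> bool" where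
  "no_internal_zeros a \<longleftrightarrow>
     \<not> (\<exists>i j k. i < j \<and> j < k \<and> coeff a j = 0 \<and> coeff a i * coeff a k \<noteq> 0)"

text \<open>The upper index \<open>e\<close> of \<open>a(x) = a\<^sub>0 + \<dots> + a\<^sub>e x\<^sup>e\<close> is taken to be \<^term>\<open>degree a\<close>; padding with zero
  coefficients up to a larger \<open>e \<le> m\<close> only adds inequalities whose right-hand side is 0.\<close>

definition ULC :: "nat \<Rightarrow> real poly set" where
  "ULC m = {a. (\<forall>j. coeff a j \<ge> 0) \<and> degree a \<le> m \<and>
               log_concave_upto (degree a) (\<lambda>j. coeff a j / real (m choose j)) \<and>
               no_internal_zeros a}"

lemma values_fps_nth [simp]: "fps_nth (values_fps p) j = poly p (of_nat j)"
  by (simp add: values_fps_def)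

lemma degree_backward_diff_less:
  fixes p :: "real poly"
  assumes "degree p > 0"
  shows "degree (p - pcompose p [:-1, 1:]) < degree p"
proof -
  have deg: "degree (pcompose p [:-1, 1:]) = degree p"
    by (simp add: degree_pcompose)
  have "lead_coeff (pcompose p [:-1, 1:]) = lead_coeff p"
    by (subst lead_coeff_comp) auto
  hence "coeff (p - pcompose p [:-1, 1:]) (degree p) = 0"
    using deg by simp
  moreover have "degree (p - pcompose p [:-1, 1:]) \<le> degree p"
    using deg by (intro degree_diff_le) auto
  ultimately show ?thesis
    using assms by (metis degree_0 leading_coeff_0_iff le_neq_implies_less)
qed

lemma values_fps_times_power:
  assumes "degree p \<le> d"
  shows "\<exists>w. degree w \<le> d \<and> values_fps p * (1 - fps_X) ^ (d + 1) = fps_of_poly w"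
  using assms
proof (induction d arbitrary: p)
  case 0
  then obtain c where p: "p = [:c:]"
    using degree_eq_zeroE by blast
  have "values_fps p * (1 - fps_X) = fps_of_poly [:c:]"
    by (rule fps_ext) (auto simp: p algebra_simps coeff_pCons split: nat.splits)
  thus ?case
    by (intro exI[of _ "[:c:]"]) simp
next
  case (Suc d)
  define q where "q = p - pcompose p [:-1, 1:]"
  define c where "c = poly p 0 - poly q 0"
  have "degree q \<le> d"
  proof (cases "degree p = 0")
    case True
    then obtain b where "p = [:b:]"
      using degree_eq_zeroE by blast
    thus ?thesis by (simp add: q_def)
  next
    case False
    thus ?thesis
      using degree_backward_diff_less[of p] Suc.prems by (simp add: q_def)
  qed
  from Suc.IH[OF this] obtain w where
    w: "degree w \<le> d" "values_fps q * (1 - fps_X) ^ (d + 1) = fps_of_poly w"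
    by blast
  have step: "values_fps p * (1 - fps_X) = values_fps q + fps_const c"
  proof (rule fps_ext)
    fix n
    show "(values_fps p * (1 - fps_X)) $ n = (values_fps q + fps_const c) $ n"
      by (cases n) (auto simp: algebra_simps q_def c_def poly_pcompose)
  qed
  have one: "fps_of_poly [:1, -1:] = (1 - fps_X :: real fps)"
    by (simp add: fps_of_poly_linear' flip: fps_const_neg)
  define v where "v = w + smult c ([:1, -1:] ^ (d + 1))"
  have "degree ([:1, -1:] ^ (d + 1) :: real poly) \<le> d + 1"
    by (rule order_trans[OF degree_power_le]) simp
  hence "degree v \<le> Suc d"
    using w(1) unfolding v_def by (intro degree_add_le order_trans[OF degree_smult_le]) auto
  moreover have "values_fps p * (1 - fps_X) ^ (Suc d + 1) = fps_of_poly v"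
  proof -
    have "values_fps p * (1 - fps_X) ^ (Suc d + 1) =
            (values_fps p * (1 - fps_X)) * (1 - fps_X) ^ (d + 1)"
      by (simp add: mult_ac)
    also have "\<dots> = values_fps q * (1 - fps_X) ^ (d + 1) + fps_const c * (1 - fps_X) ^ (d + 1)"
      by (simp only: step distrib_right)
    also have "\<dots> = fps_of_poly v"
      by (simp only: w(2) v_def fps_of_poly_add fps_of_poly_smult fps_of_poly_power one)
    finally show ?thesis .
  qed
  ultimately show ?case by blast
qed

lemma eq_divide_one_minus_fps_X_power_iff:
  fixes f g :: "real fps"
  shows "f = g / (1 - fps_X) ^ n \<longleftrightarrow> f * (1 - fps_X) ^ n = g"
proof -
  have "((1 - fps_X) ^ n :: real fps) $ 0 \<noteq> 0"
    by (simp add: fps_power_zeroth)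
  hence "is_unit ((1 - fps_X) ^ n :: real fps)"
    by simp
  thus ?thesis
    by (metis dvd_div_mult_self unit_imp_dvd nonzero_mult_div_cancel_right not_is_unit_0)
qed

lemma W_poly_unique:
  assumes "values_fps p = fps_of_poly w / (1 - fps_X) ^ (degree p + 1)"
  shows "W_poly p = w"
  unfolding W_poly_def
proof (rule the_equality)
  fix v assume "values_fps p = fps_of_poly v / (1 - fps_X) ^ (degree p + 1)"
  hence "fps_of_poly v = fps_of_poly w"
    using assms by (metis eq_divide_one_minus_fps_X_power_iff)
  thus "v = w"
    by (simp add: fps_of_poly_eq_iff)
qed (fact assms)

lemma values_fps_eq_W_poly:
  "values_fps p = fps_of_poly (W_poly p) / (1 - fps_X) ^ (degree p + 1)"
  and degree_W_poly_le: "degree (W_poly p) \<le> degree p"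
proof -
  obtain w where w: "degree w \<le> degree p"
      "values_fps p * (1 - fps_X) ^ (degree p + 1) = fps_of_poly w"
    using values_fps_times_power[OF order_refl] by blast
  hence eq: "values_fps p = fps_of_poly w / (1 - fps_X) ^ (degree p + 1)"
    by (simp only: eq_divide_one_minus_fps_X_power_iff)
  show "values_fps p = fps_of_poly (W_poly p) / (1 - fps_X) ^ (degree p + 1)"
    and "degree (W_poly p) \<le> degree p"
    using eq w(1) W_poly_unique[OF eq] by simp_all
qed

end

theory Submission
  imports Defs "HOL-Analysis.Analysis"
begin

text \<open>
  Let \<open>d, e\<close> be the degrees, \<open>m = d + e\<close>, and let \<open>F, G\<close> be the binary forms of degree \<open>d, e\<close> whose
  coefficients are those of the two given W-polynomials. The coefficients of the W-polynomial of the
  product are those of the coefficient of \<open>r\<^sup>d\<close> in \<open>F(s(r + t), t(r + s)) G(r + s, r + t)\<close>, a form of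
  degree \<open>m\<close> in \<open>s, t\<close>. The ternary form \<open>F(s(r + t), t(r + s))\<close> is Lorentzian: its derivatives of order
  \<open>2d - 2\<close> are explicit ternary quadratic forms, and log-concavity of the normalised coefficients of \<open>F\<close>
  shows that they have at most one positive eigenvalue. Hence
  \<open>F(s(r + t), t(r + s)) G(X, Y)\<close> is Lorentzian, and so are its directional derivatives in nonnegative
  directions, by the local-to-global principle behind the Alexandrov--Fenchel inequality. The resulting
  binary quadratic forms give exactly the inequalities of ultra log-concavity. Vanishing coefficients
  are treated by approximation with positive log-concave sequences.
\<close>

unbundle no fps_syntax

section \<open>Lorentzian quadratic forms\<close>

text \<open>Where the substitution comes from: it sends X^i Y^(d-i) in F times X^j Y^(e-j) in G to
  s^i t^(d-i) (r+s)^(d+j-i) (r+t)^(e+i-j). There r^d s^k t^(d+e-k) has the coefficient C(d+j-i, k-i)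
  C(e+i-j, k-j), which is also the coefficient of C(n+d+e-k, d+e) in the product C(n+d-i, d)
  C(n+e-j, e). The price is that F is evaluated at quadratic arguments. Nonnegative linear
  substitutions preserve the Lorentzian property, which settles G, but the ternary form made from F
  has to be checked by hand; log-concavity alone is too weak there and needs a reverse inequality
  for averaged sequences. Two limits are taken. The spectral argument wants strictly positive
  directions, whereas the directions that pick out r, s and t have zero entries; and the supports
  must be known exactly, hence positive sequences. Limits keep the inequalities but say nothing
  about which coefficients vanish, so internal zeros are excluded separately, from the explicit
  coefficients.\<close>

definition bil :: "('a::finite \<Rightarrow> 'a \<Rightarrow> real) \<Rightarrow> ('a \<Rightarrow> real) \<Rightarrow> ('a \<Rightarrow> real) \<Rightarrow> real" where
  "bil Q x y = (\<Sum>i\<in>UNIV. \<Sum>j\<in>UNIV. Q i j * x i * y j)"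

text \<open>For symmetric \<open>Q\<close> this is equivalent to having at most one positive
  eigenvalue. Written as a reversed Cauchy-Schwarz inequality it avoids spectral theory and is
  already the inequality read off at the end.\<close>

definition lorentzian :: "('a::finite \<Rightarrow> 'a \<Rightarrow> real) \<Rightarrow> bool" where
  "lorentzian Q \<longleftrightarrow>
     (\<forall>x y. bil Q x x > 0 \<longrightarrow> bil Q y y > 0 \<longrightarrow> bil Q x x * bil Q y y \<le> (bil Q x y)\<^sup>2)"

lemma bil_lincomb_left:
  "bil Q (\<lambda>i. a * x i + b * y i) z = a * bil Q x z + b * bil Q y z"
  by (simp add: bil_def sum_distrib_left sum.distrib[symmetric] algebra_simps)

lemma bil_lincomb_right:
  "bil Q z (\<lambda>i. a * x i + b * y i) = a * bil Q z x + b * bil Q z y"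
  by (simp add: bil_def sum_distrib_left sum.distrib[symmetric] algebra_simps)

lemma bil_commute:
  assumes "\<And>i j. Q i j = Q j i"
  shows "bil Q x y = bil Q y x"
  unfolding bil_def by (subst sum.swap) (simp add: assms mult_ac)

lemma bil_square_lincomb:
  assumes "\<And>i j. Q i j = Q j i"
  shows "bil Q (\<lambda>i. a * x i + b * y i) (\<lambda>i. a * x i + b * y i) =
           a\<^sup>2 * bil Q x x + 2 * a * b * bil Q x y + b\<^sup>2 * bil Q y y"
  using bil_commute[of Q x y, OF assms]
  by (simp add: bil_lincomb_left bil_lincomb_right algebra_simps power2_eq_square)

text \<open>Vectors with positive square lie off the hyperplane, while
  \<open>l y * x - l x * y\<close> lies in it; nonpositivity at this one vector bounds the
  discriminant. The case \<open>c = 0\<close> is included, \<open>Q\<close> being nonpositive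
  everywhere then.\<close>

lemma lorentzian_if_nonpos_on_hyperplane:
  fixes Q :: "'a::finite \<Rightarrow> 'a \<Rightarrow> real"
  assumes sym: "\<And>i j. Q i j = Q j i"
    and hyp: "\<And>x. (\<Sum>i\<in>UNIV. c i * x i) = 0 \<Longrightarrow> bil Q x x \<le> 0"
  shows "lorentzian Q"
  unfolding lorentzian_def
proof (intro allI impI)
  fix x y assume pos: "bil Q x x > 0" "bil Q y y > 0"
  define l where "l z = (\<Sum>i\<in>UNIV. c i * z i)" for z
  have lx: "l x \<noteq> 0" using hyp[of x] pos unfolding l_def by auto
  have "l (\<lambda>i. a * x i + b * y i) = a * l x + b * l y" for a b
    unfolding l_def by (simp add: sum_distrib_left sum.distrib[symmetric] algebra_simps)
  hence "l (\<lambda>i. l y * x i + (- l x) * y i) = l y * l x + (- l x) * l y" .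
  hence "bil Q (\<lambda>i. l y * x i + (- l x) * y i) (\<lambda>i. l y * x i + (- l x) * y i) \<le> 0"
    using hyp unfolding l_def by simp
  moreover have "bil Q (\<lambda>i. l y * x i + (- l x) * y i) (\<lambda>i. l y * x i + (- l x) * y i) =
      (l y)\<^sup>2 * bil Q x x + 2 * l y * (- l x) * bil Q x y + (- l x)\<^sup>2 * bil Q y y"
    by (rule bil_square_lincomb[OF sym])
  ultimately have le: "(l y)\<^sup>2 * bil Q x x - 2 * l x * l y * bil Q x y + (l x)\<^sup>2 * bil Q y y \<le> 0"
    by (simp only:) (simp add: mult_ac)
  have "(l x)\<^sup>2 * (bil Q x x * bil Q y y - (bil Q x y)\<^sup>2) =
      bil Q x x * ((l y)\<^sup>2 * bil Q x x - 2 * l x * l y * bil Q x y + (l x)\<^sup>2 * bil Q y y)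
      - (l y * bil Q x x - l x * bil Q x y)\<^sup>2"
    by (simp add: algebra_simps power2_eq_square)
  also have "\<dots> \<le> 0"
    using le pos by (smt (verit) mult_nonneg_nonpos zero_le_power2)
  finally show "bil Q x x * bil Q y y \<le> (bil Q x y)\<^sup>2"
    using lx by (simp add: mult_le_0_iff)
qed

text \<open>First-order condition at a maximum, in place of differentiating a Rayleigh
  quotient.\<close>

lemma linear_coeff_zero_if_quadratic_nonpos:
  fixes b c :: real
  assumes "\<And>s. s * b + s\<^sup>2 * c \<le> 0"
  shows "b = 0"
proof (rule ccontr)
  assume "b \<noteq> 0"
  \<comment> \<open>At \<open>s = b / M\<close> the linear term wins because \<open>M + c\<close> is
    at least 1.\<close>
  define M where "M = \<bar>c\<bar> + 1"
  have M: "M > 0" "c \<ge> - M + 1" by (auto simp: M_def)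
  have "(b / M) * b + (b / M)\<^sup>2 * c = b\<^sup>2 / M\<^sup>2 * (M + c)"
    using M by (simp add: field_simps power2_eq_square)
  also have "\<dots> > 0" using M \<open>b \<noteq> 0\<close> by (intro mult_pos_pos divide_pos_pos) auto
  finally show False using assms[of "b / M"] by simp
qed

text \<open>The Bochner-type argument for the Alexandrov--Fenchel inequality: with \<open>D = diag(Qw / w)\<close>, the
  hypothesis on the slices bounds \<open>\<langle>x, Ax\<rangle>\<^sub>D\<close> by \<open>\<langle>Ax, Ax\<rangle>\<^sub>D\<close> for \<open>A = D\<inverse> Q\<close>, so positive eigenvalues of \<open>A\<close>
  are at least 1; the Perron eigenvector \<open>w\<close> accounts for the only such eigenvalue.\<close>

lemma lorentzian_cubic_contraction:
  fixes t :: "'a::finite \<Rightarrow> 'a \<Rightarrow> 'a \<Rightarrow> real"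
  assumes sym1: "\<And>i j k. t i j k = t j i k" and sym2: "\<And>i j k. t i j k = t i k j"
    and nonneg: "\<And>i j k. t i j k \<ge> 0"
    and lor: "\<And>i. lorentzian (t i)"
    and w: "\<And>i. w i > 0"
    and conn: "\<And>(u :: 'a \<Rightarrow> real) j k. (\<And>i j k. t i j k > 0 \<Longrightarrow> u j = u k) \<Longrightarrow>
      (\<exists>i l. t i j l > 0) \<Longrightarrow> (\<exists>i l. t i k l > 0) \<Longrightarrow> u j = u k"
  shows "lorentzian (\<lambda>j k. \<Sum>i\<in>UNIV. w i * t i j k)"
proof -
  define Q where "Q j k = (\<Sum>i\<in>UNIV. w i * t i j k)" for j k
  define R where "R i = (\<Sum>j\<in>UNIV. Q i j * w j)" for i
  \<comment> \<open>The value 1 on indices with \<open>R i = 0\<close> keeps the inner product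
    weighted by \<open>D\<close> definite; those rows of \<open>Q\<close> vanish anyway.\<close>
  define D where "D i = (if R i > 0 then R i / w i else 1)" for i
  have w0: "w i \<ge> 0" for i using w[of i] by simp
  have Qsym: "Q i j = Q j i" for i j unfolding Q_def using sym2 by metis
  have Qnn: "Q i j \<ge> 0" for i j unfolding Q_def by (intro sum_nonneg mult_nonneg_nonneg w0 nonneg)
  have Rnn: "R i \<ge> 0" for i unfolding R_def by (intro sum_nonneg mult_nonneg_nonneg w0 Qnn)
  have Dpos: "D i > 0" for i unfolding D_def using w[of i] by auto
  have row: "(\<Sum>j\<in>UNIV. Q i j * x j) = bil (t i) w x" for i x
  proof -
    have "(\<Sum>j\<in>UNIV. Q i j * x j) = (\<Sum>j\<in>UNIV. \<Sum>k\<in>UNIV. t i k j * w k * x j)"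
      unfolding Q_def sum_distrib_right by (intro sum.cong refl) (simp add: sym1[of i] mult_ac)
    also have "\<dots> = bil (t i) w x" unfolding bil_def by (rule sum.swap)
    finally show ?thesis .
  qed
  have RQ: "Q i j = 0" if "R i = 0" for i j
  proof -
    have "\<forall>j\<in>UNIV. Q i j * w j = 0"
      using that unfolding R_def by (subst (asm) sum_nonneg_eq_0_iff) (auto intro: mult_nonneg_nonneg Qnn w0)
    thus ?thesis using w[of j] by (metis UNIV_I less_irrefl mult_eq_0_iff)
  qed
  have Qt: "Q j k > 0" if "t i j k > 0" for i j k
  proof -
    have "0 < w i * t i j k" using that w by simp
    also have "\<dots> \<le> Q j k" unfolding Q_def
      by (rule member_le_sum[of i UNIV "\<lambda>i. w i * t i j k"]) (auto intro: mult_nonneg_nonneg w0 nonneg)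
    finally show ?thesis .
  qed
  have tQ: "\<exists>i. t i j k > 0" if "Q j k > 0" for j k
  proof (rule ccontr)
    assume "\<not> ?thesis"
    hence "t i j k = 0" for i using nonneg[of i j k] by (metis less_eq_real_def)
    thus False using that by (simp add: Q_def)
  qed
  have Rt: "t i j k = 0" if "R i = 0" for i j k
    using RQ[OF that, of j] Qt[of k i j] nonneg[of i j k] sym1 sym2 by (metis less_eq_real_def less_irrefl)
  have bilQ: "bil Q x y = (\<Sum>i\<in>UNIV. (\<Sum>j\<in>UNIV. Q i j * y j) * x i)" for x y
    unfolding bil_def sum_distrib_right by (simp add: mult_ac)
  have bilQw: "bil Q x w = (\<Sum>i\<in>UNIV. R i * x i)" for x
    unfolding bilQ R_def ..
  have bilQt: "bil Q x x = (\<Sum>i\<in>UNIV. w i * bil (t i) x x)" for x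
  proof -
    have "bil Q x x = (\<Sum>j\<in>UNIV. \<Sum>k\<in>UNIV. \<Sum>i\<in>UNIV. w i * (t i j k * x j * x k))"
      unfolding bil_def Q_def by (simp add: sum_distrib_left sum_distrib_right mult_ac)
    also have "\<dots> = (\<Sum>j\<in>UNIV. \<Sum>i\<in>UNIV. \<Sum>k\<in>UNIV. w i * (t i j k * x j * x k))"
      by (intro sum.cong refl sum.swap)
    also have "\<dots> = (\<Sum>i\<in>UNIV. \<Sum>j\<in>UNIV. \<Sum>k\<in>UNIV. w i * (t i j k * x j * x k))"
      by (rule sum.swap)
    also have "\<dots> = (\<Sum>i\<in>UNIV. w i * bil (t i) x x)"
      unfolding bil_def by (simp add: sum_distrib_left)
    finally show ?thesis .
  qed
  \<comment> \<open>The inequality of slice \<open>t i\<close> is applied to \<open>w\<close> and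
    \<open>x\<close>: by \<open>row\<close>, \<open>bil (t i) w x\<close> is the entry of
    \<open>Q x\<close> at \<open>i\<close>, and \<open>bil (t i) w w\<close> is
    \<open>R i\<close>.\<close>
  have bochner: "bil Q x x \<le> (\<Sum>i\<in>UNIV. (\<Sum>j\<in>UNIV. Q i j * x j)\<^sup>2 / D i)" for x
    unfolding bilQt
  proof (rule sum_mono)
    fix i
    show "w i * bil (t i) x x \<le> (\<Sum>j\<in>UNIV. Q i j * x j)\<^sup>2 / D i"
    proof (cases "bil (t i) x x > 0")
      case False
      hence "w i * bil (t i) x x \<le> 0" using w[of i] by (simp add: mult_le_0_iff)
      also have "0 \<le> (\<Sum>j\<in>UNIV. Q i j * x j)\<^sup>2 / D i" using Dpos[of i] by simp
      finally show ?thesis .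
    next
      case True
      have "R i \<noteq> 0" using True Rt[of i] by (auto simp: bil_def)
      hence R: "R i > 0" using Rnn[of i] by simp
      have Rb: "R i = bil (t i) w w" unfolding R_def row ..
      have "bil (t i) w w * bil (t i) x x \<le> (bil (t i) w x)\<^sup>2"
        using lor[of i] True R Rb unfolding lorentzian_def by simp
      hence "R i * bil (t i) x x \<le> (\<Sum>j\<in>UNIV. Q i j * x j)\<^sup>2" by (simp add: row Rb)
      thus ?thesis using R w[of i] by (simp add: D_def field_simps)
    qed
  qed
  \<comment> \<open>This hyperplane is orthogonal to \<open>w\<close> for \<open>Q\<close>. If
    \<open>Q\<close> were positive somewhere on it, a maximiser of \<open>bil Q x x\<close> on the
    unit sphere of \<open>ip\<close> in it would be a second eigenvector with positive
    eigenvalue.\<close>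
  have "bil Q x0 x0 \<le> 0" if x0: "bil Q x0 w = 0" for x0
  proof (rule ccontr)
    assume "\<not> bil Q x0 x0 \<le> 0"
    hence x0pos: "bil Q x0 x0 > 0" by simp
    define ip where "ip x y = (\<Sum>i\<in>UNIV. D i * x i * y i)" for x y
    have ip_pos: "ip x x > 0" if "x i \<noteq> 0" for x i
    proof -
      have "0 < D i * x i * x i" using that Dpos[of i] by (simp add: mult.assoc zero_less_mult_iff) (meson linorder_neqE_linordered_idom)
      also have "\<dots> \<le> ip x x" unfolding ip_def
        by (rule member_le_sum[of i UNIV "\<lambda>i. D i * x i * x i"])
          (use Dpos in \<open>auto simp: mult.assoc less_imp_le\<close>)
      finally show ?thesis .
    qed
    have scale: "bil Q (\<lambda>i. c * x i) (\<lambda>i. c * x i) = c\<^sup>2 * bil Q x x"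
      "bil Q (\<lambda>i. c * x i) y = c * bil Q x y"
      "ip (\<lambda>i. c * x i) (\<lambda>i. c * x i) = c\<^sup>2 * ip x x" for c x y
      by (simp_all add: bil_def ip_def sum_distrib_left power2_eq_square mult_ac)
    define K where "K = {x::real^'a. ip (\<lambda>i. x $ i) (\<lambda>i. x $ i) = 1 \<and> bil Q (\<lambda>i. x $ i) w = 0}"
    have "closed K"
    proof -
      have "K = {x. ip (\<lambda>i. x $ i) (\<lambda>i. x $ i) = 1} \<inter> {x. bil Q (\<lambda>i. x $ i) w = 0}"
        by (auto simp: K_def)
      moreover have "closed {x::real^'a. ip (\<lambda>i. x $ i) (\<lambda>i. x $ i) = 1}"
        unfolding ip_def by (intro closed_Collect_eq continuous_intros)
      moreover have "closed {x::real^'a. bil Q (\<lambda>i. x $ i) w = 0}"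
        unfolding bil_def by (intro closed_Collect_eq continuous_intros)
      ultimately show ?thesis by auto
    qed
    moreover have "bounded K"
    proof -
      define B where "B = (\<Sum>i\<in>UNIV. 1 + 1 / D i)"
      have "norm x \<le> B" if "x \<in> K" for x
      proof -
        have "\<bar>x $ i\<bar> \<le> 1 + 1 / D i" for i
        proof -
          have "D i * x $ i * x $ i \<le> ip (\<lambda>i. x $ i) (\<lambda>i. x $ i)" unfolding ip_def
            by (rule member_le_sum[of i UNIV "\<lambda>i. D i * x $ i * x $ i"])
              (use Dpos in \<open>auto simp: mult.assoc less_imp_le\<close>)
          hence "D i * (x $ i)\<^sup>2 \<le> 1" using that by (simp add: K_def power2_eq_square mult.assoc)
          hence le: "(x $ i)\<^sup>2 \<le> 1 / D i" using Dpos[of i] by (simp add: field_simps)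
          show ?thesis
          proof (cases "\<bar>x $ i\<bar> \<le> 1")
            case True
            moreover have "1 / D i \<ge> 0" using Dpos[of i] by simp
            ultimately show ?thesis by linarith
          next
            case False
            hence "\<bar>x $ i\<bar> * 1 \<le> \<bar>x $ i\<bar> * \<bar>x $ i\<bar>" by (intro mult_left_mono) auto
            thus ?thesis using le by (simp add: power2_eq_square)
          qed
        qed
        hence "(\<Sum>i\<in>UNIV. \<bar>x $ i\<bar>) \<le> B" unfolding B_def by (intro sum_mono)
        thus ?thesis using norm_le_l1_cart[of x] by linarith
      qed
      thus ?thesis by (auto simp: bounded_iff)
    qed
    ultimately have "compact K" by (simp add: compact_eq_bounded_closed)
    have vec_fun: "($) (vec_lambda f) = f" for f :: "'a \<Rightarrow> real" by (rule ext) simp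
    have norm_in_K: "(\<chi> i. x i / sqrt (ip x x)) \<in> K \<and>
        bil Q (\<lambda>i. x i / sqrt (ip x x)) (\<lambda>i. x i / sqrt (ip x x)) = bil Q x x / ip x x"
      if "ip x x > 0" "bil Q x w = 0" for x
    proof -
      define c where "c = 1 / sqrt (ip x x)"
      have c: "c\<^sup>2 = 1 / ip x x" using that by (simp add: c_def power_divide)
      have eq: "(\<lambda>i. x i / sqrt (ip x x)) = (\<lambda>i. c * x i)" by (simp add: c_def)
      show ?thesis
        unfolding K_def mem_Collect_eq vec_fun eq scale c using that by simp
    qed
    have "\<exists>i. x0 i \<noteq> 0" 
    proof (rule ccontr)
      assume "\<not> ?thesis"
      thus False using x0pos by (simp add: bil_def)
    qed
    hence ip0: "ip x0 x0 > 0" using ip_pos by blast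
    have ne: "K \<noteq> {}" using norm_in_K[OF ip0 x0] by blast
    have "continuous_on K (\<lambda>x. bil Q (\<lambda>i. x $ i) (\<lambda>i. x $ i))"
      unfolding bil_def by (intro continuous_intros)
    from continuous_attains_sup[OF \<open>compact K\<close> ne this] obtain xm where xm: "xm \<in> K"
      and max: "\<And>y. y \<in> K \<Longrightarrow> bil Q (\<lambda>i. y $ i) (\<lambda>i. y $ i) \<le> bil Q (\<lambda>i. xm $ i) (\<lambda>i. xm $ i)"
      by blast
    define x where "x = ($) xm"
    define lam where "lam = bil Q x x"
    have xw: "bil Q x w = 0" and xx: "ip x x = 1" using xm by (auto simp: K_def x_def)
    have max': "bil Q y y / ip y y \<le> lam" if "ip y y > 0" "bil Q y w = 0" for y
      using max[of "\<chi> i. y i / sqrt (ip y y)"] norm_in_K[OF that]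
      by (simp only: vec_fun lam_def x_def)
    have lampos: "lam > 0"
    proof -
      have "0 < bil Q x0 x0 / ip x0 x0" using x0pos ip0 by simp
      also have "\<dots> \<le> lam" using max'[OF ip0 x0] .
      finally show ?thesis .
    qed
    have ray: "bil Q y y \<le> lam * ip y y" if "bil Q y w = 0" for y
    proof (cases "\<exists>i. y i \<noteq> 0")
      case True
      hence "ip y y > 0" using ip_pos by blast
      with max'[OF this that] show ?thesis by (simp add: field_simps)
    next
      case False
      thus ?thesis by (simp add: bil_def ip_def)
    qed
    have ip_lin: "ip x (\<lambda>i. a * y i + b * z i) = a * ip x y + b * ip x z" for x y z a b
      by (simp add: ip_def sum_distrib_left sum.distrib[symmetric] algebra_simps)
    have ip_sq: "ip (\<lambda>i. a * y i + b * z i) (\<lambda>i. a * y i + b * z i) =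
        a\<^sup>2 * ip y y + 2 * a * b * ip y z + b\<^sup>2 * ip z z" for y z a b
      by (simp add: ip_def sum_distrib_left sum.distrib[symmetric] algebra_simps power2_eq_square)
    have crit: "bil Q x y = lam * ip x y" if y: "bil Q y w = 0" for y
    proof -
      have "s * (2 * (bil Q x y - lam * ip x y)) + s\<^sup>2 * (bil Q y y - lam * ip y y) \<le> 0" for s
      proof -
        have "bil Q (\<lambda>i. 1 * x i + s * y i) w = 0" using y xw by (simp only: bil_lincomb_left)
        from ray[OF this] show ?thesis
          by (simp only: bil_square_lincomb[OF Qsym] ip_sq) (simp add: lam_def[symmetric] xx algebra_simps)
      qed
      from linear_coeff_zero_if_quadratic_nonpos[OF this] show ?thesis by simp
    qed
    \<comment> \<open>Where \<open>R i = 0\<close> the weight \<open>D\<close> is artificial.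
      Cutting \<open>w\<close> down to the other indices changes no pairing with \<open>Q\<close>
      and makes it \<open>ip\<close>-orthogonal to \<open>x\<close>, so the criticality of
      \<open>x\<close> extends from the hyperplane to all \<open>y\<close>.\<close>
    define w' where "w' i = (if R i > 0 then w i else 0)" for i
    have w'Q: "bil Q y w' = bil Q y w" for y
      unfolding bil_def w'_def
      by (intro sum.cong refl) (metis Qsym RQ Rnn less_eq_real_def mult_zero_left)
    have ipw': "ip x w' = 0"
    proof -
      have "ip x w' = (\<Sum>i\<in>UNIV. R i * x i)" unfolding ip_def
        by (intro sum.cong refl) (use w Rnn in \<open>auto simp: D_def w'_def less_le field_simps\<close>)
      thus ?thesis using xw bilQw by simp
    qed
    have "\<exists>i. R i > 0"
    proof (rule ccontr)
      assume "\<not> ?thesis"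
      hence "R i = 0" for i using Rnn[of i] by (metis less_eq_real_def)
      hence "Q i j = 0" for i j using RQ by blast
      thus False using x0pos by (simp add: bil_def)
    qed
    then obtain i0 where i0: "R i0 > 0" by blast
    have "0 < R i0 * w i0" using i0 w by simp
    also have "\<dots> \<le> bil Q w w" unfolding bilQw
      by (rule member_le_sum[of i0 UNIV "\<lambda>i. R i * w i"]) (auto intro: mult_nonneg_nonneg w0 Rnn)
    finally have ww: "bil Q w w > 0" .
    have w'w: "bil Q w' w = bil Q w w"
      using w'Q[of w] bil_commute[of Q w' w, OF Qsym] by simp
    have crit': "bil Q x y = lam * ip x y" for y
    proof -
      define c where "c = bil Q y w / bil Q w w"
      have "bil Q (\<lambda>i. 1 * y i + (- c) * w' i) w = 0"
        using ww by (simp only: bil_lincomb_left[of Q 1 y "- c" w' w] w'w) (simp add: c_def)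
      from crit[OF this] show ?thesis
        by (simp only: bil_lincomb_right[of Q x 1 y "- c" w'] ip_lin[of x 1 y "- c" w'] w'Q)
          (simp add: ipw' xw)
    qed
    have eig: "(\<Sum>j\<in>UNIV. Q i j * x j) = lam * D i * x i" for i
    proof -
      have "bil Q x (\<lambda>j. if j = i then 1 else 0) = (\<Sum>j\<in>UNIV. Q i j * x j)"
        by (simp add: bil_def Qsym[of _ i] if_distrib[of "\<lambda>z. _ * z"] cong: if_cong)
      moreover have "ip x (\<lambda>j. if j = i then 1 else 0) = D i * x i"
        by (simp add: ip_def if_distrib[of "\<lambda>z. _ * z"] cong: if_cong)
      ultimately show ?thesis using crit'[of "\<lambda>j. if j = i then 1 else 0"] by (simp only: mult.assoc)
    qed
    \<comment> \<open>The eigenvector inserted into \<open>bochner\<close> gives that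
      \<open>lam\<close> is at most its square; being positive, it is at least the eigenvalue 1 of
      \<open>w'\<close>.\<close>
    have "lam \<le> (\<Sum>i\<in>UNIV. (lam * D i * x i)\<^sup>2 / D i)"
      using bochner[of x] by (simp only: eig lam_def)
    also have "\<dots> = lam\<^sup>2 * ip x x" unfolding ip_def sum_distrib_left
      using Dpos by (intro sum.cong refl) (auto simp: field_simps power2_eq_square less_imp_neq[symmetric])
    finally have lam1: "lam \<ge> 1" using lampos xx by (simp add: power2_eq_square)
    define u where "u i = x i / w i" for i
    have xu: "x i = u i * w i" for i using w[of i] by (simp add: u_def)
    \<comment> \<open>In place of the Perron-Frobenius theorem: the Dirichlet form of
      \<open>u\<close> is at most \<open>2 * (1 - lam)\<close>, so it vanishes, and \<open>u\<close>
      is constant along the edges of the graph of \<open>Q\<close>.\<close>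
    have "(\<Sum>i\<in>UNIV. \<Sum>j\<in>UNIV. Q i j * w i * w j * (u i - u j)\<^sup>2) =
        (\<Sum>i\<in>UNIV. \<Sum>j\<in>UNIV. Q i j * w i * w j * (u i)\<^sup>2) +
        (\<Sum>i\<in>UNIV. \<Sum>j\<in>UNIV. Q i j * w i * w j * (u j)\<^sup>2) - 2 * bil Q x x"
      unfolding bil_def xu
      by (simp add: sum_distrib_left sum.distrib[symmetric] sum_subtractf[symmetric] algebra_simps power2_eq_square)
    also have "(\<Sum>i\<in>UNIV. \<Sum>j\<in>UNIV. Q i j * w i * w j * (u j)\<^sup>2) =
        (\<Sum>i\<in>UNIV. \<Sum>j\<in>UNIV. Q i j * w i * w j * (u i)\<^sup>2)"
      by (subst sum.swap) (simp add: Qsym mult_ac)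
    also have "(\<Sum>i\<in>UNIV. \<Sum>j\<in>UNIV. Q i j * w i * w j * (u i)\<^sup>2) = (\<Sum>i\<in>UNIV. R i * w i * (u i)\<^sup>2)"
      unfolding R_def sum_distrib_right by (simp add: mult_ac)
    also have "(\<Sum>i\<in>UNIV. R i * w i * (u i)\<^sup>2) \<le> ip x x" unfolding ip_def
    proof (rule sum_mono)
      fix i
      show "R i * w i * (u i)\<^sup>2 \<le> D i * x i * x i"
      proof (cases "R i > 0")
        case True
        thus ?thesis using w[of i] by (simp add: D_def xu power2_eq_square)
      next
        case False
        hence "R i = 0" using Rnn[of i] by simp
        thus ?thesis by (simp add: D_def)
      qed
    qed
    finally have le0: "(\<Sum>i\<in>UNIV. \<Sum>j\<in>UNIV. Q i j * w i * w j * (u i - u j)\<^sup>2) \<le> 0"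
      using lam1 xx by (simp add: lam_def)
    have edge: "u i = u j" if "Q i j > 0" for i j
    proof -
      have nn: "Q i j * w i * w j * (u i - u j)\<^sup>2 \<ge> 0" for i j
        by (intro mult_nonneg_nonneg Qnn w0) auto
      have "Q i j * w i * w j * (u i - u j)\<^sup>2 \<le> (\<Sum>j\<in>UNIV. Q i j * w i * w j * (u i - u j)\<^sup>2)"
        by (rule member_le_sum[of j UNIV]) (use nn in auto)
      also have "\<dots> \<le> (\<Sum>i\<in>UNIV. \<Sum>j\<in>UNIV. Q i j * w i * w j * (u i - u j)\<^sup>2)"
        by (rule member_le_sum[of i UNIV "\<lambda>i. \<Sum>j\<in>UNIV. Q i j * w i * w j * (u i - u j)\<^sup>2"])
          (use nn in \<open>auto intro: sum_nonneg\<close>)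
      finally have "Q i j * w i * w j * (u i - u j)\<^sup>2 = 0" using le0 nn[of i j] by linarith
      thus ?thesis using that w[of i] w[of j] by simp
    qed
    have const: "u j = u i0" if "R j > 0" for j
    proof (rule conn)
      show "u j = u k" if "t i j k > 0" for i j k using edge Qt that by blast
      have live: "\<exists>i l. t i j l > 0" if R: "R j > 0" for j
      proof -
        have "\<exists>l. Q j l > 0"
        proof (rule ccontr)
          assume "\<not> ?thesis"
          hence "Q j l = 0" for l using Qnn[of j l] by (metis less_eq_real_def)
          thus False using R by (simp add: R_def)
        qed
        thus ?thesis using tQ by blast
      qed
      show "\<exists>i l. t i j l > 0" "\<exists>i l. t i i0 l > 0" using live that i0 by blast+
    qed
    have xdead: "x i = 0" if "\<not> R i > 0" for i
    proof -
      have "R i = 0" using that Rnn[of i] by simp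
      hence "(\<Sum>j\<in>UNIV. Q i j * x j) = 0" using RQ by simp
      thus ?thesis using eig[of i] lampos Dpos[of i] by simp
    qed
    \<comment> \<open>Now \<open>x\<close> is a multiple of \<open>w'\<close>. As
      \<open>bil Q x w = 0\<close> and \<open>bil Q w w > 0\<close>, the factor is 0, against
      \<open>ip x x = 1\<close>.\<close>
    have xw': "x i = u i0 * w' i" for i
      using xdead[of i] const[of i] by (simp add: w'_def xu)
    have "bil Q x w = u i0 * bil Q w w"
      using scale(2)[of "u i0" w' w] w'w xw' by (metis (no_types, lifting) ext)
    hence "u i0 = 0" using xw ww by simp
    hence "x i = 0" for i using xw' by simp
    thus False using xx by (simp add: ip_def)
  qed
  hence "lorentzian Q"
    by (intro lorentzian_if_nonpos_on_hyperplane[of Q R] Qsym) (simp add: bilQw)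
  thus ?thesis unfolding Q_def[abs_def] .
qed

section \<open>Contractions of symmetric tensors\<close>

text \<open>A form of degree \<open>n\<close> is encoded by its partial derivatives of order
  \<open>n\<close>, indexed by multisets of variables, which builds in the symmetry. In this
  encoding \<open>contract v\<close> is differentiation in direction \<open>v\<close>.\<close>

definition contract ::
  "('a::finite \<Rightarrow> real) \<Rightarrow> ('a multiset \<Rightarrow> real) \<Rightarrow> 'a multiset \<Rightarrow> real" where
  "contract v f M = (\<Sum>i\<in>UNIV. v i * f (add_mset i M))"

text \<open>One predicate \<open>A\<close> describes the supports in all degrees, and positivity is
  prescribed exactly, so that the connectedness needed at each differentiation becomes a
  combinatorial property of \<open>A\<close>.\<close>

definition lorentzian_tensor ::
  "('a::finite multiset \<Rightarrow> bool) \<Rightarrow> nat \<Rightarrow> ('a multiset \<Rightarrow> real) \<Rightarrow> bool" where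
  "lorentzian_tensor A n f \<longleftrightarrow>
     (\<forall>M. f M \<ge> 0) \<and> (\<forall>M. f M > 0 \<longleftrightarrow> A M \<and> size M = n) \<and>
     (\<forall>M. size M + 2 = n \<longrightarrow> lorentzian (\<lambda>i j. f (add_mset i (add_mset j M))))"

text \<open>In \<open>conn\<close>, \<open>j\<close> and \<open>k\<close> are joined when
  \<open>M\<close> can be enlarged by both, and the possible one-step enlargements must form a
  connected graph. It is phrased by functions constant along edges because it is applied to the
  quotient of an eigenvector by \<open>w\<close>.\<close>

locale connected_support =
  fixes A :: "'a::finite multiset \<Rightarrow> bool" and r :: nat
  assumes down: "A (add_mset i M) \<Longrightarrow> A M"
    and extend: "A M \<Longrightarrow> size M < r \<Longrightarrow> \<exists>i. A (add_mset i M)"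
    and conn: "A M \<Longrightarrow> size M + 3 \<le> r \<Longrightarrow>
      (\<And>j k. A (add_mset j (add_mset k M)) \<Longrightarrow> u j = (u k :: real)) \<Longrightarrow>
      A (add_mset j M) \<Longrightarrow> A (add_mset k M) \<Longrightarrow> u j = u k"
begin

text \<open>The slices of the cubic tensor at \<open>M\<close> are the quadratic forms of
  \<open>f\<close> at \<open>add_mset i M\<close>, so \<open>lorentzian_cubic_contraction\<close>
  applies at each \<open>M\<close>. By \<open>extend\<close>, every edge at \<open>M\<close> comes
  from a positive cubic entry.\<close>

lemma lorentzian_tensor_contract:
  assumes f: "lorentzian_tensor A (Suc n) f" and n: "Suc n \<le> r" and w: "\<And>i. w i > 0"
  shows "lorentzian_tensor A n (contract w f)"
proof -
  have nn: "f M \<ge> 0" and pos: "f M > 0 \<longleftrightarrow> A M \<and> size M = Suc n" for M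
    using f by (auto simp: lorentzian_tensor_def)
  have w0: "w i \<ge> 0" for i using w[of i] by simp
  have cnn: "contract w f M \<ge> 0" for M
    unfolding contract_def by (intro sum_nonneg mult_nonneg_nonneg w0 nn)
  have cpos: "contract w f M > 0 \<longleftrightarrow> A M \<and> size M = n" for M
  proof
    assume "contract w f M > 0"
    hence "(\<Sum>i\<in>UNIV. w i * f (add_mset i M)) \<noteq> 0" by (simp add: contract_def)
    then obtain i where "w i * f (add_mset i M) \<noteq> 0" using sum.not_neutral_contains_not_neutral by blast
    hence "f (add_mset i M) > 0" using nn[of "add_mset i M"] by (auto simp: less_le)
    thus "A M \<and> size M = n" using pos down by auto
  next
    assume *: "A M \<and> size M = n"
    then obtain i where "A (add_mset i M)" using extend[of M] n by auto
    hence "0 < w i * f (add_mset i M)" using pos w * by simp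
    also have "\<dots> \<le> contract w f M" unfolding contract_def
      by (rule member_le_sum[of i UNIV "\<lambda>i. w i * f (add_mset i M)"])
        (auto intro: mult_nonneg_nonneg w0 nn)
    finally show "contract w f M > 0" .
  qed
  have "lorentzian (\<lambda>i j. contract w f (add_mset i (add_mset j M)))" if M: "size M + 2 = n" for M
  proof (cases "A M")
    case True
    have "lorentzian (\<lambda>j k. \<Sum>i\<in>UNIV. w i * f (add_mset i (add_mset j (add_mset k M))))"
    proof (rule lorentzian_cubic_contraction)
      fix i show "lorentzian (\<lambda>j k. f (add_mset i (add_mset j (add_mset k M))))"
      proof -
        have "lorentzian (\<lambda>j k. f (add_mset j (add_mset k (add_mset i M))))"
          using f M unfolding lorentzian_tensor_def by simp
        thus ?thesis by (simp only: add_mset_commute[of i])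
      qed
    next
      fix u :: "'a \<Rightarrow> real" and j k
      assume u: "\<And>i j k. f (add_mset i (add_mset j (add_mset k M))) > 0 \<Longrightarrow> u j = u k"
        and j: "\<exists>i l. f (add_mset i (add_mset j (add_mset l M))) > 0"
        and k: "\<exists>i l. f (add_mset i (add_mset k (add_mset l M))) > 0"
      show "u j = u k"
      proof (rule conn[of M])
        show "size M + 3 \<le> r" using M n by simp
        show "u j = u k" if jk: "A (add_mset j (add_mset k M))" for j k
        proof -
          obtain i where "A (add_mset i (add_mset j (add_mset k M)))"
            using extend[OF jk] M n by auto
          thus ?thesis using u pos M by simp
        qed
      next
        show "A (add_mset j M)" "A (add_mset k M)"
        proof -
          from j obtain i l where "A (add_mset i (add_mset j (add_mset l M)))" using pos by blast
          from down[OF this] show "A (add_mset j M)" using down by (subst (asm) add_mset_commute)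
          from k obtain i l where "A (add_mset i (add_mset k (add_mset l M)))" using pos by blast
          from down[OF this] show "A (add_mset k M)" using down by (subst (asm) add_mset_commute)
        qed
      qed (fact True)
    qed (use nn w in \<open>auto simp: add_mset_commute\<close>)
    thus ?thesis by (simp add: contract_def)
  next
    case False
    have "contract w f (add_mset i (add_mset j M)) = 0" for i j
    proof -
      have "\<not> A (add_mset i (add_mset j M))" using False down by blast
      thus ?thesis
        using cpos[of "add_mset i (add_mset j M)"] cnn[of "add_mset i (add_mset j M)"] by simp
    qed
    thus ?thesis by (simp add: lorentzian_def bil_def)
  qed
  thus ?thesis using cnn cpos by (simp add: lorentzian_tensor_def)
qed

lemma lorentzian_tensor_contract_funpow:
  assumes "lorentzian_tensor A (n + k) f" "n + k \<le> r" "\<And>i. w i > 0"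
  shows "lorentzian_tensor A n ((contract w ^^ k) f)"
  using assms(1,2)
proof (induction k arbitrary: n)
  case (Suc k)
  have "lorentzian_tensor A (Suc n) ((contract w ^^ k) f)" using Suc by simp
  thus ?case using lorentzian_tensor_contract[of n] Suc.prems assms(3) by simp
qed simp

end

lemma contract_commute: "contract x (contract y f) = contract y (contract x f)"
proof
  fix M
  have "contract x (contract y f) M = (\<Sum>i\<in>UNIV. \<Sum>j\<in>UNIV. x i * y j * f (add_mset j (add_mset i M)))"
    by (simp add: contract_def sum_distrib_left mult_ac)
  also have "\<dots> = (\<Sum>j\<in>UNIV. \<Sum>i\<in>UNIV. x i * y j * f (add_mset j (add_mset i M)))"
    by (rule sum.swap)
  also have "\<dots> = contract y (contract x f) M"
    by (simp add: contract_def sum_distrib_left mult_ac add_mset_commute)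
  finally show "contract x (contract y f) M = contract y (contract x f) M" .
qed

lemma contract_funpow_commute:
  "contract x ((contract y ^^ n) f) = (contract y ^^ n) (contract x f)"
  by (induction n) (simp_all add: contract_commute[of x y])

text \<open>All but two contractions leave a quadratic form \<open>Q\<close>. Since contractions
  commute, the three values of \<open>Z\<close> are \<open>bil Q y y\<close>,
  \<open>bil Q z z\<close> and \<open>bil Q y z\<close>, and the claim is the reversed
  Cauchy-Schwarz inequality.\<close>

lemma (in connected_support) contract_log_concave:
  assumes f: "lorentzian_tensor A r f" and r: "r = a + b + c + 2"
    and pos: "\<And>i. x i > 0" "\<And>i. y i > 0" "\<And>i. z i > 0"
  defines "Z \<equiv> \<lambda>b c. (contract x ^^ a) ((contract y ^^ b) ((contract z ^^ c) f)) {#}"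
  shows "Z (b + 2) c * Z b (c + 2) \<le> (Z (b + 1) (c + 1))\<^sup>2"
proof -
  define g where "g = (contract x ^^ a) ((contract y ^^ b) ((contract z ^^ c) f))"
  have "lorentzian_tensor A (2 + a + b) ((contract z ^^ c) f)"
    by (rule lorentzian_tensor_contract_funpow) (use f r pos in \<open>auto simp: add_ac\<close>)
  hence "lorentzian_tensor A (2 + a) ((contract y ^^ b) ((contract z ^^ c) f))"
    by (rule lorentzian_tensor_contract_funpow) (use r pos in auto)
  hence g: "lorentzian_tensor A 2 g"
    unfolding g_def by (rule lorentzian_tensor_contract_funpow) (use r pos in auto)
  define Q where "Q i j = g {#i, j#}" for i j
  have Q: "lorentzian Q" using g unfolding lorentzian_tensor_def Q_def[abs_def] by auto
  have bil: "bil Q u v = contract u (contract v g) {#}" for u v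
    by (simp add: bil_def Q_def contract_def sum_distrib_left mult_ac add_mset_commute)
  have yy: "Z (b + 2) c = bil Q y y"
    unfolding bil Z_def g_def by (simp add: contract_funpow_commute[where x=y and y=x])
  have zz: "Z b (c + 2) = bil Q z z"
    unfolding bil Z_def g_def by (simp add: contract_funpow_commute[where x=z and y=x] contract_funpow_commute[where x=z and y=y])
  have yz: "Z (b + 1) (c + 1) = bil Q y z"
    unfolding bil Z_def g_def
    by (simp add: contract_funpow_commute[where x=y and y=x] contract_funpow_commute[where x=z and y=x] contract_funpow_commute[where x=z and y=y])
  have nn: "bil Q u u \<ge> 0" if "\<And>i. u i > 0" for u
    unfolding bil_def Q_def using g that
    by (intro sum_nonneg mult_nonneg_nonneg) (auto simp: lorentzian_tensor_def less_imp_le)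
  show ?thesis
  proof (cases "bil Q y y > 0 \<and> bil Q z z > 0")
    case True
    thus ?thesis using Q unfolding yy zz yz lorentzian_def by blast
  next
    case False
    hence "bil Q y y * bil Q z z = 0" using nn[of y, OF pos(2)] nn[of z, OF pos(3)] by auto
    thus ?thesis unfolding yy zz yz by (simp only: zero_le_power2)
  qed
qed

section \<open>Iterated sums of log-concave sequences\<close>

text \<open>The operator \<open>1 + shift\<close> iterated \<open>n\<close> times, see
  \<open>pascal_eq_sum\<close>. Up to factorials these numbers are the coefficients of F(s(r + t),
  t(r + s)) in r, s, t.\<close>

primrec pascal :: "(nat \<Rightarrow> real) \<Rightarrow> nat \<Rightarrow> nat \<Rightarrow> real" where
  "pascal a 0 i = a i"
| "pascal a (Suc n) i = pascal a n i + pascal a n (Suc i)"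

lemma pascal_pos: "(\<And>i. a i > 0) \<Longrightarrow> pascal a n i > 0"
  by (induction n arbitrary: i) (auto intro: add_pos_pos)

text \<open>Two neighbouring inequalities multiply to \<open>z 0 * z 3 \<le> z 1 * z 2\<close>, the
  one product in the next row that they do not bound directly.\<close>

lemma pascal_log_concave:
  assumes pos: "\<And>i. a i > 0" and lc: "\<And>i. a i * a (i + 2) \<le> (a (i + 1))\<^sup>2"
  shows "pascal a n i * pascal a n (i + 2) \<le> (pascal a n (i + 1))\<^sup>2"
proof (induction n arbitrary: i)
  case 0
  show ?case using lc by simp
next
  case (Suc n)
  define z where "z j = pascal a n (i + j)" for j
  have z: "z j > 0" for j by (simp add: z_def pascal_pos pos)
  have 1: "z 0 * z 2 \<le> (z 1)\<^sup>2" and 2: "z 1 * z 3 \<le> (z 2)\<^sup>2"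
    using Suc.IH[of i] Suc.IH[of "i + 1"] by (simp_all add: z_def numeral_eq_Suc)
  have "z 1 * z 2 * (z 0 * z 3) = (z 0 * z 2) * (z 1 * z 3)" by (simp add: mult_ac)
  also have "\<dots> \<le> (z 1)\<^sup>2 * (z 2)\<^sup>2"
    using 1 2 z by (intro mult_mono) (auto simp: less_imp_le)
  also have "\<dots> = z 1 * z 2 * (z 1 * z 2)" by (simp add: power2_eq_square mult_ac)
  finally have 3: "z 0 * z 3 \<le> z 1 * z 2" using z by simp
  have "(z 0 + z 1) * (z 2 + z 3) \<le> (z 1 + z 2)\<^sup>2"
    using 1 2 3 by (simp add: algebra_simps power2_eq_square)
  thus ?case by (simp add: z_def numeral_eq_Suc)
qed

text \<open>With \<open>z\<^sub>0, z\<^sub>1, z\<^sub>2\<close> three consecutive entries of row \<open>n\<close>, this says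
  \<open>z\<^sub>1 / (z\<^sub>0 + z\<^sub>1) + z\<^sub>1 / (z\<^sub>1 + z\<^sub>2) \<le> (n + 2) / (n + 1)\<close>: averaging prevents the rows from being too concave.\<close>

lemma pascal_reverse_log_concave:
  assumes pos: "\<And>i. a i > 0"
  shows "real (n + 1) * pascal a n (i + 1) * (pascal a n i + 2 * pascal a n (i + 1) + pascal a n (i + 2)) \<le>
    real (n + 2) * (pascal a n i + pascal a n (i + 1)) * (pascal a n (i + 1) + pascal a n (i + 2))"
proof (induction n arbitrary: i)
  case 0
  have "a i > 0" "a (i + 1) > 0" "a (i + 2) > 0" using pos by auto
  hence "0 \<le> a i * a (i + 1) + a (i + 1) * a (i + 2) + 2 * (a i * a (i + 2))" by simp
  thus ?case by (simp add: algebra_simps)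
next
  case (Suc n)
  define z where "z j = pascal a n (i + j)" for j
  have z: "z j > 0" for j by (simp add: z_def pascal_pos pos)
  define P Q S where "P = z 0 + z 1" and "Q = z 1 + z 2" and "S = z 2 + z 3"
  have pos': "P > 0" "Q > 0" "S > 0" using z by (simp_all add: P_def Q_def S_def add_pos_pos)
  have 1: "real (n + 1) * z 1 * (P + Q) \<le> real (n + 2) * P * Q"
    using Suc.IH[of i] by (simp add: z_def P_def Q_def numeral_eq_Suc add_ac)
  have 2: "real (n + 1) * z 2 * (Q + S) \<le> real (n + 2) * Q * S"
    using Suc.IH[of "i + 1"] by (simp add: z_def S_def Q_def numeral_eq_Suc add_ac)
  \<comment> \<open>The weights \<open>Q + S\<close> and \<open>P + Q\<close> make the left sides
    add up to a multiple of \<open>z 1 + z 2\<close>, which is \<open>Q\<close> and cancels.\<close>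
  have "real (n + 1) * z 1 * (P + Q) * (Q + S) + real (n + 1) * z 2 * (Q + S) * (P + Q)
      \<le> real (n + 2) * P * Q * (Q + S) + real (n + 2) * Q * S * (P + Q)"
    using 1 2 pos' by (intro add_mono mult_right_mono) auto
  moreover have "real (n + 1) * z 1 * (P + Q) * (Q + S) + real (n + 1) * z 2 * (Q + S) * (P + Q)
      = Q * (real (n + 1) * (P + Q) * (Q + S))"
    by (simp add: Q_def algebra_simps)
  moreover have "real (n + 2) * P * Q * (Q + S) + real (n + 2) * Q * S * (P + Q) =
      Q * (real (n + 2) * (P * (Q + S) + S * (P + Q)))"
    by (simp add: algebra_simps)
  ultimately have "real (n + 1) * (P + Q) * (Q + S) \<le> real (n + 2) * (P * (Q + S) + S * (P + Q))"
    using pos' by (simp del: of_nat_add of_nat_Suc)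
  hence "real (Suc n + 1) * Q * (P + 2 * Q + S) \<le> real (Suc n + 2) * (P + Q) * (Q + S)"
    by (simp add: algebra_simps)
  thus ?case by (simp add: z_def P_def Q_def S_def numeral_eq_Suc)
qed

section \<open>Discriminants of the ternary quadratic forms\<close>

lemma two_mult_le_if_square_le:
  fixes A B x X Y :: real
  assumes "A \<ge> 0" "B \<ge> 0" "x\<^sup>2 \<le> A * B"
  shows "2 * x * X * Y \<le> A * X\<^sup>2 + B * Y\<^sup>2"
proof (rule power2_le_imp_le)
  have "(2 * x * X * Y)\<^sup>2 = x\<^sup>2 * (4 * (X * Y)\<^sup>2)" by (simp add: power_mult_distrib mult_ac)
  also have "\<dots> \<le> (A * B) * (4 * (X * Y)\<^sup>2)" using assms by (intro mult_right_mono) auto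
  also have "\<dots> = (A * X\<^sup>2 + B * Y\<^sup>2)\<^sup>2 - (A * X\<^sup>2 - B * Y\<^sup>2)\<^sup>2"
    by (simp add: power2_eq_square algebra_simps)
  also have "\<dots> \<le> (A * X\<^sup>2 + B * Y\<^sup>2)\<^sup>2" by simp
  finally show "(2 * x * X * Y)\<^sup>2 \<le> (A * X\<^sup>2 + B * Y\<^sup>2)\<^sup>2" .
  show "0 \<le> A * X\<^sup>2 + B * Y\<^sup>2" using assms by simp
qed

text \<open>Only bounds on \<theta> are available. As \<open>\<theta> * kg - 1\<close> is increasing
  in \<theta>, its square is bounded by the values at the ends of [1, 1 + 1/g], which are the
  squares of \<open>kg - 1\<close> and \<open>1 / (a + b + 1)\<close>. At either end, clearing
  denominators leaves a difference whose coefficients are all nonnegative.\<close>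

lemma kappa_discriminant:
  fixes a b g \<theta> :: real
  assumes nn: "a \<ge> 0" "b \<ge> 0" "g > 0" and \<theta>: "1 \<le> \<theta>" "g * \<theta> \<le> g + 1"
  defines "\<kappa> \<equiv> \<lambda>x y :: real. x * (y + 2) / ((x + 1) * (y + 1))"
  defines "ka \<equiv> \<kappa> a (b + g)" and "kb \<equiv> \<kappa> b (a + g)" and "kg \<equiv> \<kappa> g (a + b)"
  shows "ka * kg \<le> 1" "kb * kg \<le> 1" "(\<theta> * kg - 1)\<^sup>2 \<le> (1 - ka * kg) * (1 - kb * kg)"
proof -
  define S where "S = a + b + g + 3"
  \<comment> \<open>\<open>N1\<close> and \<open>N2\<close> are the numerators of
    \<open>1 - ka * kg\<close> and \<open>1 - kb * kg\<close> after splitting off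
    \<open>b + 1\<close> and \<open>a + 1\<close>.\<close>
  define N1 where "N1 = (a + g + 1) * S - 2 * (a + 1) * (g + 1)"
  define N2 where "N2 = (b + g + 1) * S - 2 * (b + 1) * (g + 1)"
  have N1: "N1 = a\<^sup>2 + g\<^sup>2 + a * b + b * g + 2 * a + 2 * g + b + 1"
    by (simp add: N1_def S_def algebra_simps power2_eq_square)
  have N2: "N2 = b\<^sup>2 + g\<^sup>2 + a * b + a * g + 2 * b + 2 * g + a + 1"
    by (simp add: N2_def S_def algebra_simps power2_eq_square)
  have N: "N1 \<ge> 0" "N2 \<ge> 0" unfolding N1 N2 using nn by (auto intro!: add_nonneg_nonneg mult_nonneg_nonneg)
  have d: "a + 1 > 0" "b + 1 > 0" "g + 1 > 0" "a + b + 1 > 0" "a + g + 1 > 0" "b + g + 1 > 0"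
    using nn by auto
  have e1: "1 - ka * kg = (b + 1) * N1 / ((a + 1) * (g + 1) * (b + g + 1) * (a + b + 1))"
  proof -
    define D where "D = (a + 1) * (g + 1) * (b + g + 1) * (a + b + 1)"
    have "ka * kg = a * (b + g + 2) * g * (a + b + 2) / D"
      by (simp add: ka_def kg_def \<kappa>_def D_def mult_ac)
    moreover have "D > 0" using d by (simp add: D_def)
    moreover have "D - a * (b + g + 2) * g * (a + b + 2) = (b + 1) * N1"
      unfolding D_def N1 by algebra
    ultimately show ?thesis unfolding D_def[symmetric] by (simp add: field_simps)
  qed
  have e2: "1 - kb * kg = (a + 1) * N2 / ((b + 1) * (g + 1) * (a + g + 1) * (a + b + 1))"
  proof -
    define D where "D = (b + 1) * (g + 1) * (a + g + 1) * (a + b + 1)"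
    have "kb * kg = b * (a + g + 2) * g * (a + b + 2) / D"
      by (simp add: kb_def kg_def \<kappa>_def D_def mult_ac)
    moreover have "D > 0" using d by (simp add: D_def)
    moreover have "D - b * (a + g + 2) * g * (a + b + 2) = (a + 1) * N2"
      unfolding D_def N2 by algebra
    ultimately show ?thesis unfolding D_def[symmetric] by (simp add: field_simps)
  qed
  have p1: "0 \<le> 1 - ka * kg" and p2: "0 \<le> 1 - kb * kg"
    unfolding e1 e2 using d N by (auto intro!: divide_nonneg_pos mult_pos_pos mult_nonneg_nonneg)
  show "ka * kg \<le> 1" "kb * kg \<le> 1" using p1 p2 by auto
  have prod: "(1 - ka * kg) * (1 - kb * kg) =
      (N1 * N2 / ((g + 1)\<^sup>2 * (b + g + 1) * (a + g + 1))) / (a + b + 1)\<^sup>2"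
  proof -
    have "r * N1 / (p * q * u * s) * (p * N2 / (r * q * v * s)) = (N1 * N2 / (q\<^sup>2 * u * v)) / s\<^sup>2"
      if "p > 0" "r > 0" for p q r s u v :: real
      using that by (simp add: power2_eq_square)
    thus ?thesis unfolding e1 e2 using d by blast
  qed
  have kg0: "kg \<ge> 0" unfolding kg_def \<kappa>_def using nn by simp
  have lo: "\<theta> * kg - 1 \<ge> kg - 1" using \<theta> kg0 by (simp add: mult_le_cancel_right1)
  have hi: "\<theta> * kg - 1 \<le> 1 / (a + b + 1)"
  proof -
    have "\<theta> * kg = (g * \<theta>) * ((a + b + 2) / ((g + 1) * (a + b + 1)))"
      by (simp add: kg_def \<kappa>_def)
    also have "\<dots> \<le> (g + 1) * ((a + b + 2) / ((g + 1) * (a + b + 1)))"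
      using \<theta> nn by (intro mult_right_mono divide_nonneg_nonneg mult_nonneg_nonneg) auto
    also have "\<dots> = (a + b + 2) / (a + b + 1)" using d by simp
    also have "\<dots> = 1 + 1 / (a + b + 1)" using d by (simp add: field_simps)
    finally show ?thesis by simp
  qed
  have lo2: "(kg - 1)\<^sup>2 \<le> (1 - ka * kg) * (1 - kb * kg)"
  proof -
    have "kg - 1 = (g - a - b - 1) / ((g + 1) * (a + b + 1))"
    proof -
      define D where "D = (g + 1) * (a + b + 1)"
      have "D > 0" using d by (simp add: D_def)
      moreover have "g * (a + b + 2) - D = g - a - b - 1" by (simp add: D_def algebra_simps)
      ultimately show ?thesis unfolding kg_def \<kappa>_def D_def[symmetric] by (simp add: field_simps)
    qed
    hence "(kg - 1)\<^sup>2 = ((g - a - b - 1)\<^sup>2 / (g + 1)\<^sup>2) / (a + b + 1)\<^sup>2"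
      by (simp add: power_divide power_mult_distrib)
    also have "\<dots> \<le> (N1 * N2 / ((g + 1)\<^sup>2 * (b + g + 1) * (a + g + 1))) / (a + b + 1)\<^sup>2"
    proof (rule divide_right_mono)
      have "(g - a - b - 1)\<^sup>2 * ((b + g + 1) * (a + g + 1)) \<le> N1 * N2"
      proof -
        have "N1 * N2 - (g - a - b - 1)\<^sup>2 * ((b + g + 1) * (a + g + 1)) =
          4*g + 8*g*g + 4*g*g*g + 6*b*g + 8*b*g*g + 2*b*g*g*g + 2*b*b*g + 2*b*b*g*g + 6*a*g + 8*a*g*g
          + 2*a*g*g*g + 4*a*b*g + 4*a*b*g*g + 2*a*a*g + 2*a*a*g*g"
          unfolding N1 N2 by algebra
        also have "\<dots> \<ge> 0" using nn by simp
        finally show ?thesis by simp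
      qed
      moreover have "x / q \<le> n / (q * u * v)" if "x * (u * v) \<le> n" "q > 0" "u > 0" "v > 0"
        for x q n u v :: real
        using that by (simp add: field_simps)
      ultimately show "(g - a - b - 1)\<^sup>2 / (g + 1)\<^sup>2 \<le>
          N1 * N2 / ((g + 1)\<^sup>2 * (b + g + 1) * (a + g + 1))"
        using d by simp
    qed simp
    finally show ?thesis unfolding prod .
  qed
  have hi2: "(1 / (a + b + 1))\<^sup>2 \<le> (1 - ka * kg) * (1 - kb * kg)"
  proof -
    have "(g + 1)\<^sup>2 * (b + g + 1) * (a + g + 1) \<le> N1 * N2"
    proof -
      have "N1 * N2 - (g + 1)\<^sup>2 * (b + g + 1) * (a + g + 1) =
          2*b + 4*b*g + 2*b*g*g + 3*b*b + 4*b*b*g + b*b*g*g + b*b*b + b*b*b*g + 2*a + 4*a*g + 2*a*g*g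
          + 6*a*b + 4*a*b*g + 2*a*b*g*g + 5*a*b*b + a*b*b*g + a*b*b*b + 3*a*a + 4*a*a*g + a*a*g*g
          + 5*a*a*b + a*a*b*g + 2*a*a*b*b + a*a*a + a*a*a*g + a*a*a*b"
        unfolding N1 N2 by algebra
      also have "\<dots> \<ge> 0" using nn by simp
      finally show ?thesis by simp
    qed
    hence "1 \<le> N1 * N2 / ((g + 1)\<^sup>2 * (b + g + 1) * (a + g + 1))" using d by simp
    hence "1 / (a + b + 1)\<^sup>2 \<le> (N1 * N2 / ((g + 1)\<^sup>2 * (b + g + 1) * (a + g + 1))) / (a + b + 1)\<^sup>2"
      by (rule divide_right_mono) simp
    thus ?thesis unfolding prod by (simp add: power_divide)
  qed
  show "(\<theta> * kg - 1)\<^sup>2 \<le> (1 - ka * kg) * (1 - kb * kg)"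
  proof (cases "\<theta> * kg - 1 \<ge> 0")
    case True
    hence "(\<theta> * kg - 1)\<^sup>2 \<le> (1 / (a + b + 1))\<^sup>2" using hi by (intro power_mono)
    thus ?thesis using hi2 by linarith
  next
    case False
    hence "(- (\<theta> * kg - 1))\<^sup>2 \<le> (- (kg - 1))\<^sup>2" using lo by (intro power_mono) auto
    thus ?thesis using lo2 unfolding power2_minus by linarith
  qed
qed

text \<open>The constraint is orthogonality to the Z-axis for the form itself. Multiplying by
  \<open>\<kappa> g (a + b)\<close> and eliminating Z leaves a binary form, which
  \<open>kappa_discriminant\<close> makes negative semidefinite. For \<open>g = 0\<close> the
  multiplier vanishes and the constraint reads \<open>Y = - X\<close>.\<close>

lemma kappa_form_nonpos:
  fixes a b g \<theta> X Y Z :: real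
  assumes nn: "a \<ge> 0" "b \<ge> 0" "g \<ge> 0" and \<theta>: "1 \<le> \<theta>" "g * \<theta> \<le> g + 1"
  defines "\<kappa> \<equiv> \<lambda>x y :: real. x * (y + 2) / ((x + 1) * (y + 1))"
  assumes hyp: "\<kappa> g (a + b) * Z + X + Y = 0"
  shows "\<kappa> a (b + g) * X\<^sup>2 + \<kappa> b (a + g) * Y\<^sup>2 + \<kappa> g (a + b) * Z\<^sup>2
    + 2 * \<theta> * X * Y + 2 * X * Z + 2 * Y * Z \<le> 0" (is "?F \<le> 0")
proof (cases "g = 0")
  case True
  hence kg: "\<kappa> g (a + b) = 0" by (simp add: \<kappa>_def)
  hence Y: "Y = - X" using hyp by simp
  have "\<kappa> a (b + g) + \<kappa> b (a + g) = 2 - 2 / ((a + 1) * (b + 1))"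
  proof -
    define D where "D = (a + 1) * (b + 1)"
    have "\<kappa> a (b + g) = a * (b + 2) / D" "\<kappa> b (a + g) = b * (a + 2) / D"
      by (simp_all add: \<kappa>_def D_def True mult_ac)
    moreover have "D > 0" using nn by (simp add: D_def)
    moreover have "a * (b + 2) + b * (a + 2) = 2 * D - 2" by (simp add: D_def algebra_simps)
    ultimately show ?thesis unfolding D_def[symmetric] by (simp add: field_simps)
  qed
  also have "\<dots> \<le> 2 * \<theta>" using \<theta> nn by (smt (verit) divide_nonneg_nonneg mult_nonneg_nonneg)
  finally have "(\<kappa> a (b + g) + \<kappa> b (a + g) - 2 * \<theta>) * X\<^sup>2 \<le> 0"
    by (simp add: mult_le_0_iff)
  thus ?thesis using kg by (simp add: Y algebra_simps power2_eq_square)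
next
  case False
  hence g: "g > 0" using nn by simp
  define ka kb kg where "ka = \<kappa> a (b + g)" and "kb = \<kappa> b (a + g)" and "kg = \<kappa> g (a + b)"
  have kg: "kg > 0" unfolding kg_def \<kappa>_def using nn g by simp
  have disc: "ka * kg \<le> 1" "kb * kg \<le> 1" "(\<theta> * kg - 1)\<^sup>2 \<le> (1 - ka * kg) * (1 - kb * kg)"
    using kappa_discriminant[OF nn(1,2) g \<theta>] by (simp_all only: ka_def kb_def kg_def \<kappa>_def)
  have XY: "kg * Z = - (X + Y)" using hyp unfolding kg_def by simp
  have "kg * ?F = kg * ka * X\<^sup>2 + kg * kb * Y\<^sup>2 + (kg * Z)\<^sup>2 + 2 * kg * \<theta> * X * Y + 2 * (X + Y) * (kg * Z)"
    by (simp add: ka_def kb_def kg_def algebra_simps power2_eq_square)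
  also have "\<dots> = 2 * (\<theta> * kg - 1) * X * Y - ((1 - ka * kg) * X\<^sup>2 + (1 - kb * kg) * Y\<^sup>2)"
    unfolding XY by (simp add: algebra_simps power2_eq_square)
  also have "\<dots> \<le> 0"
    using two_mult_le_if_square_le[of "1 - ka * kg" "1 - kb * kg" "\<theta> * kg - 1" X Y] disc by simp
  finally show ?thesis using kg by (simp add: mult_le_0_iff)
qed

section \<open>The Lorentzian tensor\<close>

text \<open>For \<open>F(X, Y) = \<Sum>\<^sub>i (d choose i) a\<^sub>i X\<^sup>i Y\<^sup>d\<^sup>-\<^sup>i\<close>, the number \<open>d! q_tensor d a \<rho> \<sigma> \<tau>\<close> is the derivative
  \<open>\<partial>\<^sub>r\<^sup>\<rho> \<partial>\<^sub>s\<^sup>\<sigma> \<partial>\<^sub>t\<^sup>\<tau>\<close> of \<open>F(s(r + t), t(r + s))\<close>.\<close>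

definition q_tensor :: "nat \<Rightarrow> (nat \<Rightarrow> real) \<Rightarrow> nat \<Rightarrow> nat \<Rightarrow> nat \<Rightarrow> real" where
  "q_tensor d a r s t =
     (if r \<le> d \<and> s \<le> d \<and> t \<le> d \<and> r + s + t = 2 * d
      then fact r * fact s * fact t / (fact (d - r) * fact (d - s) * fact (d - t)) *
           pascal a (d - r) (d - t)
      else 0)"

lemma binary_form_nonpos:
  fixes A B C y z :: real
  assumes "C > 0" "A * C \<le> B\<^sup>2" "B * y + C * z = 0"
  shows "A * y\<^sup>2 + C * z\<^sup>2 + 2 * B * y * z \<le> 0"
proof -
  have "C * (A * y\<^sup>2 + C * z\<^sup>2 + 2 * B * y * z) = (B * y + C * z)\<^sup>2 - (B\<^sup>2 - A * C) * y\<^sup>2"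
    by (simp add: algebra_simps power2_eq_square)
  also have "\<dots> \<le> 0" using assms by simp
  finally show ?thesis using assms by (simp add: mult_le_0_iff)
qed

text \<open>If an exponent exceeds \<open>d\<close>, the form is 0. If one equals \<open>d\<close>,
  its variable drops out, and the binary form that remains reduces to log-concavity of a row of
  \<open>pascal\<close>. Otherwise a rescaling leads to \<open>kappa_form_nonpos\<close>.\<close>

lemma q_tensor_quadratic_nonpos:
  assumes pos: "\<And>i. a i > 0" and lc: "\<And>i. a i * a (i + 2) \<le> (a (i + 1))\<^sup>2"
    and sum: "r + s + t + 2 = 2 * d"
  shows "\<exists>c\<^sub>1 c\<^sub>2 c\<^sub>3. \<forall>x y z. c\<^sub>1 * x + c\<^sub>2 * y + c\<^sub>3 * z = (0::real) \<longrightarrow>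
    q_tensor d a (r + 2) s t * x\<^sup>2 + q_tensor d a r (s + 2) t * y\<^sup>2 + q_tensor d a r s (t + 2) * z\<^sup>2
    + 2 * q_tensor d a (r + 1) (s + 1) t * x * y + 2 * q_tensor d a (r + 1) s (t + 1) * x * z
    + 2 * q_tensor d a r (s + 1) (t + 1) * y * z \<le> 0"
    (is "\<exists>c\<^sub>1 c\<^sub>2 c\<^sub>3. ?P c\<^sub>1 c\<^sub>2 c\<^sub>3")
proof -
  have ppos: "pascal a n i > 0" for n i by (rule pascal_pos[OF pos])
  have plc: "pascal a n i * pascal a n (i + 2) \<le> (pascal a n (i + 1))\<^sup>2" for n i
    by (rule pascal_log_concave[OF pos lc])
  consider "r > d \<or> s > d \<or> t > d" | "r = d" "s + t + 2 = d" | "s = d" "r + t + 2 = d"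
    | "t = d" "r + s + 2 = d" | "r < d" "s < d" "t < d"
    using sum by linarith
  thus ?thesis
  proof cases
    case 1
    hence "?P 0 0 0" by (auto simp: q_tensor_def)
    thus ?thesis by blast
  next
    case 2
    have e: "q_tensor d a r (s + 2) t = fact d * a (s + 2)"
      "q_tensor d a r s (t + 2) = fact d * a s"
      "q_tensor d a r (s + 1) (t + 1) = fact d * a (s + 1)"
      "q_tensor d a (r + 2) s t = 0" "q_tensor d a (r + 1) (s + 1) t = 0"
      "q_tensor d a (r + 1) s (t + 1) = 0"
      using 2 by (auto simp: q_tensor_def)
    have "?P 0 (a (s + 1)) (a s)"
    proof (intro allI impI)
      fix x y z assume "0 * x + a (s + 1) * y + a s * z = 0"
      hence "a (s + 2) * y\<^sup>2 + a s * z\<^sup>2 + 2 * a (s + 1) * y * z \<le> 0"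
        using pos[of s] lc[of s] by (intro binary_form_nonpos) (auto simp: mult_ac)
      hence "fact d * (a (s + 2) * y\<^sup>2 + a s * z\<^sup>2 + 2 * a (s + 1) * y * z) \<le> 0"
        by (simp add: mult_le_0_iff)
      thus "q_tensor d a (r + 2) s t * x\<^sup>2 + q_tensor d a r (s + 2) t * y\<^sup>2 + q_tensor d a r s (t + 2) * z\<^sup>2
        + 2 * q_tensor d a (r + 1) (s + 1) t * x * y + 2 * q_tensor d a (r + 1) s (t + 1) * x * z
        + 2 * q_tensor d a r (s + 1) (t + 1) * y * z \<le> 0"
        unfolding e by (simp add: algebra_simps)
    qed
    thus ?thesis by blast
  next
    case 3
    have e: "q_tensor d a (r + 2) s t = fact d * pascal a t (r + 2)"
      "q_tensor d a r s (t + 2) = fact d * pascal a (t + 2) r"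
      "q_tensor d a (r + 1) s (t + 1) = fact d * pascal a (t + 1) (r + 1)"
      "q_tensor d a r (s + 2) t = 0" "q_tensor d a (r + 1) (s + 1) t = 0"
      "q_tensor d a r (s + 1) (t + 1) = 0"
      using 3 by (auto simp: q_tensor_def)
    have "?P (pascal a (t + 1) (r + 1)) 0 (pascal a (t + 2) r)"
    proof (intro allI impI)
      fix x y z assume "pascal a (t + 1) (r + 1) * x + 0 * y + pascal a (t + 2) r * z = 0"
      moreover have "pascal a t (r + 2) * pascal a (t + 2) r \<le> (pascal a (t + 1) (r + 1))\<^sup>2"
        using plc[of t r] by (simp add: numeral_eq_Suc algebra_simps)
      ultimately have "pascal a t (r + 2) * x\<^sup>2 + pascal a (t + 2) r * z\<^sup>2
          + 2 * pascal a (t + 1) (r + 1) * x * z \<le> 0"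
        using ppos[of "t + 2" r] by (intro binary_form_nonpos) auto
      hence "fact d * (pascal a t (r + 2) * x\<^sup>2 + pascal a (t + 2) r * z\<^sup>2
          + 2 * pascal a (t + 1) (r + 1) * x * z) \<le> 0"
        by (simp only: mult_le_0_iff) simp
      thus "q_tensor d a (r + 2) s t * x\<^sup>2 + q_tensor d a r (s + 2) t * y\<^sup>2 + q_tensor d a r s (t + 2) * z\<^sup>2
        + 2 * q_tensor d a (r + 1) (s + 1) t * x * y + 2 * q_tensor d a (r + 1) s (t + 1) * x * z
        + 2 * q_tensor d a r (s + 1) (t + 1) * y * z \<le> 0"
        unfolding e by (simp add: algebra_simps del: pascal.simps add_2_eq_Suc')
    qed
    thus ?thesis by blast
  next
    case 4
    have e: "q_tensor d a (r + 2) s t = fact d * pascal a s 0"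
      "q_tensor d a r (s + 2) t = fact d * pascal a (s + 2) 0"
      "q_tensor d a (r + 1) (s + 1) t = fact d * pascal a (s + 1) 0"
      "q_tensor d a r s (t + 2) = 0" "q_tensor d a (r + 1) s (t + 1) = 0"
      "q_tensor d a r (s + 1) (t + 1) = 0"
      using 4 by (auto simp: q_tensor_def)
    have "?P (pascal a (s + 1) 0) (pascal a (s + 2) 0) 0"
    proof (intro allI impI)
      fix x y z assume "pascal a (s + 1) 0 * x + pascal a (s + 2) 0 * y + 0 * z = 0"
      moreover have "pascal a s 0 * pascal a (s + 2) 0 \<le> (pascal a (s + 1) 0)\<^sup>2"
        using plc[of s 0] by (simp add: numeral_eq_Suc algebra_simps)
      ultimately have "pascal a s 0 * x\<^sup>2 + pascal a (s + 2) 0 * y\<^sup>2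
          + 2 * pascal a (s + 1) 0 * x * y \<le> 0"
        using ppos[of "s + 2" 0] by (intro binary_form_nonpos) auto
      hence "fact d * (pascal a s 0 * x\<^sup>2 + pascal a (s + 2) 0 * y\<^sup>2
          + 2 * pascal a (s + 1) 0 * x * y) \<le> 0"
        by (simp only: mult_le_0_iff) simp
      thus "q_tensor d a (r + 2) s t * x\<^sup>2 + q_tensor d a r (s + 2) t * y\<^sup>2 + q_tensor d a r s (t + 2) * z\<^sup>2
        + 2 * q_tensor d a (r + 1) (s + 1) t * x * y + 2 * q_tensor d a (r + 1) s (t + 1) * x * z
        + 2 * q_tensor d a r (s + 1) (t + 1) * y * z \<le> 0"
        unfolding e by (simp add: algebra_simps del: pascal.simps add_2_eq_Suc')
    qed
    thus ?thesis by blast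
  next
    case 5
    define \<alpha> \<beta> \<gamma> where "\<alpha> = d - t - 1" and "\<beta> = d - s - 1" and "\<gamma> = d - r - 1"
    have d: "d = \<alpha> + \<beta> + \<gamma> + 1" and rst: "r = \<alpha> + \<beta>" "s = \<alpha> + \<gamma>" "t = \<beta> + \<gamma>"
      using sum 5 by (simp_all add: \<alpha>_def \<beta>_def \<gamma>_def)
    define \<kappa> where "\<kappa> = (\<lambda>x y :: real. x * (y + 2) / ((x + 1) * (y + 1)))"
    define ka kb kg where "ka = \<kappa> \<alpha> (\<beta> + \<gamma>)" and "kb = \<kappa> \<beta> (\<alpha> + \<gamma>)" and "kg = \<kappa> \<gamma> (\<alpha> + \<beta>)"
    define p q where "p = pascal a \<gamma> \<alpha>" and "q = pascal a \<gamma> (\<alpha> + 1)"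
    have pq: "p > 0" "q > 0" by (auto simp: p_def q_def ppos)
    \<comment> \<open>\<open>w\<close> is the entry belonging to the square of \<open>x\<close>. For
      \<open>\<gamma> = 0\<close> that coefficient is 0, as is \<open>kg\<close>, so
      \<open>w\<close> may be chosen; this choice makes \<open>\<theta> = 1\<close>.\<close>
    define w where "w = (if \<gamma> = 0 then p * q / (p + q) else pascal a (\<gamma> - 1) (\<alpha> + 1))"
    have w: "w > 0" using pq by (simp add: w_def ppos)
    define \<theta> where "\<theta> = w * (p + q) / (p * q)"
    \<comment> \<open>For positive \<gamma> the second inequality is
      \<open>pascal_reverse_log_concave\<close>, the others are log-concavity of a row. The first
      two confine \<theta> to the range allowed by \<open>kappa_form_nonpos\<close>; the last two
      bound the remaining diagonal entries.\<close>
    have "p * q \<le> w * (p + q) \<and> \<gamma> * (w * (p + q)) \<le> (\<gamma> + 1) * (p * q)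
      \<and> w * pascal a (\<gamma> + 1) (\<alpha> + 1) \<le> q\<^sup>2
      \<and> (\<alpha> > 0 \<longrightarrow> w * pascal a (\<gamma> + 1) (\<alpha> - 1) \<le> p\<^sup>2)"
    proof (cases \<gamma>)
      case 0
      have w: "w * (p + q) = p * q" using 0 pq by (simp add: w_def)
      have 1: "p * pascal a (\<gamma> + 1) (\<alpha> + 1) \<le> q * (p + q)"
        using lc[of \<alpha>] 0 by (simp add: p_def q_def algebra_simps power2_eq_square numeral_eq_Suc)
      have "w * pascal a (\<gamma> + 1) (\<alpha> + 1) = p * pascal a (\<gamma> + 1) (\<alpha> + 1) * (q / (p + q))"
        using 0 by (simp add: w_def)
      also have "\<dots> \<le> q * (p + q) * (q / (p + q))" using 1 pq by (intro mult_right_mono) auto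
      also have "\<dots> = q\<^sup>2" using pq by (simp add: power2_eq_square)
      finally have A: "w * pascal a (\<gamma> + 1) (\<alpha> + 1) \<le> q\<^sup>2" .
      have B: "w * pascal a (\<gamma> + 1) (\<alpha> - 1) \<le> p\<^sup>2" if \<alpha>: "\<alpha> > 0"
      proof -
        have 1: "q * pascal a (\<gamma> + 1) (\<alpha> - 1) \<le> p * (p + q)"
          using lc[of "\<alpha> - 1"] 0 \<alpha> by (simp add: p_def q_def algebra_simps power2_eq_square numeral_eq_Suc)
        have "w * pascal a (\<gamma> + 1) (\<alpha> - 1) = q * pascal a (\<gamma> + 1) (\<alpha> - 1) * (p / (p + q))"
          using 0 by (simp add: w_def)
        also have "\<dots> \<le> p * (p + q) * (p / (p + q))" using 1 pq by (intro mult_right_mono) auto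
        also have "\<dots> = p\<^sup>2" using pq by (simp add: power2_eq_square)
        finally show ?thesis .
      qed
      show ?thesis using w A B 0 pq by simp
    next
      case (Suc n)
      define z where "z j = pascal a n (\<alpha> + j)" for j
      have z: "z j > 0" for j by (simp add: z_def ppos)
      have e: "w = z 1" "p = z 0 + z 1" "q = z 1 + z 2"
        "pascal a (\<gamma> + 1) (\<alpha> + 1) = z 1 + 2 * z 2 + z 3"
        using Suc by (simp_all add: w_def p_def q_def z_def numeral_eq_Suc)
      have lz: "z 0 * z 2 \<le> (z 1)\<^sup>2" "z 1 * z 3 \<le> (z 2)\<^sup>2"
        using plc[of n \<alpha>] plc[of n "\<alpha> + 1"] by (simp_all add: z_def numeral_eq_Suc)
      have "real (n + 1) * z 1 * (z 0 + 2 * z 1 + z 2) \<le> real (n + 2) * (z 0 + z 1) * (z 1 + z 2)"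
        using pascal_reverse_log_concave[of a n \<alpha>, OF pos] by (simp add: z_def)
      hence R: "\<gamma> * (w * (p + q)) \<le> (\<gamma> + 1) * (p * q)"
        using Suc unfolding e by (simp add: algebra_simps)
      have B: "w * pascal a (\<gamma> + 1) (\<alpha> - 1) \<le> p\<^sup>2" if \<alpha>: "\<alpha> > 0"
      proof -
        obtain m where m: "\<alpha> = Suc m" using \<alpha> by (cases \<alpha>) auto
        have "pascal a n m * z 1 \<le> (z 0)\<^sup>2" using plc[of n m] by (simp add: z_def m numeral_eq_Suc)
        moreover have "pascal a (\<gamma> + 1) (\<alpha> - 1) = pascal a n m + 2 * z 0 + z 1"
          using Suc m by (simp add: z_def)
        ultimately show ?thesis unfolding e by (simp add: algebra_simps power2_eq_square)
      qed
      show ?thesis using R B lz unfolding e by (simp add: algebra_simps power2_eq_square)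
    qed
    hence w1: "p * q \<le> w * (p + q)" and w2: "\<gamma> * (w * (p + q)) \<le> (\<gamma> + 1) * (p * q)"
      and w3: "w * pascal a (\<gamma> + 1) (\<alpha> + 1) \<le> q\<^sup>2"
      and w4: "\<alpha> > 0 \<Longrightarrow> w * pascal a (\<gamma> + 1) (\<alpha> - 1) \<le> p\<^sup>2" by auto
    have \<theta>: "1 \<le> \<theta>" "\<gamma> * \<theta> \<le> \<gamma> + 1"
      using w1 w2 pq by (simp_all add: \<theta>_def field_simps)
    have kpos: "ka \<ge> 0" "kb \<ge> 0" by (simp_all add: ka_def kb_def \<kappa>_def)
    \<comment> \<open>Once \<open>U\<close> is pulled out, the factorials contribute products of two
      of \<open>A\<close>, \<open>B\<close>, \<open>G\<close> off the diagonal and their squares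
      times \<open>ka\<close>, \<open>kb\<close>, \<open>kg\<close> on it. So \<kappa> is the defect
      of a diagonal entry from a perfect square.\<close>
    define U where "U = (fact (\<alpha> + \<beta>) * fact (\<alpha> + \<gamma>) * fact (\<beta> + \<gamma>) / (fact (\<gamma> + 1) * fact (\<beta> + 1) * fact (\<alpha> + 1)) :: real)"
    have U: "U > 0" by (simp add: U_def)
    define A B G where "A = (real \<alpha> + 1) * (\<beta> + \<gamma> + 1)" and "B = (real \<beta> + 1) * (\<alpha> + \<gamma> + 1)"
      and "G = (real \<gamma> + 1) * (\<alpha> + \<beta> + 1)"
    have \<kappa>sq: "\<kappa> x y * ((x + 1) * (y + 1))\<^sup>2 = x * (x + 1) * ((y + 1) * (y + 2))" if "x \<ge> 0" "y \<ge> 0" for x y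
      using that by (simp add: \<kappa>_def power2_eq_square)
    have fact1: "fact (n + 1) = (real n + 1) * (fact n :: real)"
      and fact2: "fact (n + 2) = (real n + 1) * (real n + 2) * (fact n :: real)" for n
      by (simp_all add: algebra_simps)
    have swap2: "(x * f) * (y * g) * h / (k * l * m) = f * g * h / ((u * k) * (v * l) * m) * ((u * x) * (v * y))"
      if "u > 0" "v > 0" for f g h k l m u v x y :: real
      using that by (simp add: mult_ac)
    have "q_tensor d a (r + 1) (s + 1) t =
        fact (\<alpha> + \<beta> + 1) * fact (\<alpha> + \<gamma> + 1) * fact (\<beta> + \<gamma>) / (fact \<gamma> * fact \<beta> * fact (\<alpha> + 1)) * q"
      by (simp add: q_tensor_def d rst q_def del: fact_Suc)
    also have "\<dots> = U * (G * B) * q"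
      unfolding fact1[of "\<alpha> + \<beta>"] fact1[of "\<alpha> + \<gamma>"] fact1[of \<beta>] fact1[of \<gamma>] U_def G_def B_def
      by (subst swap2[of "real \<gamma> + 1" "real \<beta> + 1"]) (simp_all add: mult_ac add_ac)
    finally have e1: "q_tensor d a (r + 1) (s + 1) t = U * (G * B) * q" .
    have "q_tensor d a (r + 1) s (t + 1) =
        fact (\<alpha> + \<beta> + 1) * fact (\<beta> + \<gamma> + 1) * fact (\<alpha> + \<gamma>) / (fact \<gamma> * fact \<alpha> * fact (\<beta> + 1)) * p"
      by (simp add: q_tensor_def d rst p_def mult_ac del: fact_Suc)
    also have "\<dots> = U * (G * A) * p"
      unfolding fact1[of "\<alpha> + \<beta>"] fact1[of "\<beta> + \<gamma>"] fact1[of \<alpha>] fact1[of \<gamma>] U_def G_def A_def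
      by (subst swap2[of "real \<gamma> + 1" "real \<alpha> + 1"]) (simp_all add: mult_ac add_ac)
    finally have e2: "q_tensor d a (r + 1) s (t + 1) = U * (G * A) * p" .
    have "q_tensor d a r (s + 1) (t + 1) =
        fact (\<alpha> + \<gamma> + 1) * fact (\<beta> + \<gamma> + 1) * fact (\<alpha> + \<beta>) / (fact \<beta> * fact \<alpha> * fact (\<gamma> + 1)) * (p + q)"
      by (simp add: q_tensor_def d rst p_def q_def mult_ac del: fact_Suc)
    also have "\<dots> = U * (B * A) * (p + q)"
      unfolding fact1[of "\<alpha> + \<gamma>"] fact1[of "\<beta> + \<gamma>"] fact1[of \<alpha>] fact1[of \<beta>] U_def B_def A_def
      by (subst swap2[of "real \<beta> + 1" "real \<alpha> + 1"]) (simp_all add: mult_ac add_ac)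
    finally have e3: "q_tensor d a r (s + 1) (t + 1) = U * (B * A) * (p + q)" .
    have swap1: "(x * y * f) * g * h / (k * l * m) = f * g * h / ((u * (v * k)) * l * m) * (v * u * (x * y))"
      if "u > 0" "v > 0" for f g h k l m u v x y :: real
      using that by (simp add: mult_ac)
    have e4: "q_tensor d a (r + 2) s t = U * (kg * G\<^sup>2) * w"
    proof (cases \<gamma>)
      case 0
      thus ?thesis by (simp add: q_tensor_def d rst kg_def \<kappa>_def)
    next
      case (Suc n)
      have K: "kg * G\<^sup>2 = real \<gamma> * (\<gamma> + 1) * ((real (\<alpha> + \<beta>) + 1) * (real (\<alpha> + \<beta>) + 2))"
        unfolding kg_def G_def using \<kappa>sq[of \<gamma> "\<alpha> + \<beta>"] by (simp add: add_ac)
      have "q_tensor d a (r + 2) s t =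
          fact (\<alpha> + \<beta> + 2) * fact (\<alpha> + \<gamma>) * fact (\<beta> + \<gamma>) / (fact n * fact (\<beta> + 1) * fact (\<alpha> + 1)) * w"
        using Suc by (simp add: q_tensor_def d rst w_def del: fact_Suc)
      also have "fact (\<alpha> + \<beta> + 2) * fact (\<alpha> + \<gamma>) * fact (\<beta> + \<gamma>) / (fact n * fact (\<beta> + 1) * fact (\<alpha> + 1))
          = U * (kg * G\<^sup>2)"
        unfolding fact2[of "\<alpha> + \<beta>"] U_def K fact1[of \<gamma>]
        by (subst swap1[of "real \<gamma> + 1" "real \<gamma>"]) (use Suc in \<open>simp_all add: mult_ac add_ac\<close>)
      finally show ?thesis .
    qed
    have e5: "q_tensor d a r (s + 2) t = U * (kb * B\<^sup>2) * pascal a (\<gamma> + 1) (\<alpha> + 1)"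
    proof (cases \<beta>)
      case 0
      thus ?thesis by (simp add: q_tensor_def d rst kb_def \<kappa>_def)
    next
      case (Suc n)
      have K: "kb * B\<^sup>2 = real \<beta> * (\<beta> + 1) * ((real (\<alpha> + \<gamma>) + 1) * (real (\<alpha> + \<gamma>) + 2))"
        unfolding kb_def B_def using \<kappa>sq[of \<beta> "\<alpha> + \<gamma>"] by (simp add: add_ac)
      have "q_tensor d a r (s + 2) t =
          fact (\<alpha> + \<gamma> + 2) * fact (\<alpha> + \<beta>) * fact (\<beta> + \<gamma>) / (fact n * fact (\<gamma> + 1) * fact (\<alpha> + 1))
          * pascal a (\<gamma> + 1) (\<alpha> + 1)"
        using Suc by (simp add: q_tensor_def d rst mult_ac del: fact_Suc pascal.simps)
      also have "fact (\<alpha> + \<gamma> + 2) * fact (\<alpha> + \<beta>) * fact (\<beta> + \<gamma>) / (fact n * fact (\<gamma> + 1) * fact (\<alpha> + 1))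
          = U * (kb * B\<^sup>2)"
        unfolding fact2[of "\<alpha> + \<gamma>"] U_def K fact1[of \<beta>]
        by (subst swap1[of "real \<beta> + 1" "real \<beta>"]) (use Suc in \<open>simp_all add: mult_ac add_ac\<close>)
      finally show ?thesis .
    qed
    have e6: "q_tensor d a r s (t + 2) = U * (ka * A\<^sup>2) * pascal a (\<gamma> + 1) (\<alpha> - 1)"
    proof (cases \<alpha>)
      case 0
      thus ?thesis by (simp add: q_tensor_def d rst ka_def \<kappa>_def)
    next
      case (Suc n)
      have K: "ka * A\<^sup>2 = real \<alpha> * (\<alpha> + 1) * ((real (\<beta> + \<gamma>) + 1) * (real (\<beta> + \<gamma>) + 2))"
        unfolding ka_def A_def using \<kappa>sq[of \<alpha> "\<beta> + \<gamma>"] by (simp add: add_ac)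
      have "q_tensor d a r s (t + 2) =
          fact (\<beta> + \<gamma> + 2) * fact (\<alpha> + \<beta>) * fact (\<alpha> + \<gamma>) / (fact n * fact (\<gamma> + 1) * fact (\<beta> + 1))
          * pascal a (\<gamma> + 1) (\<alpha> - 1)"
        using Suc by (simp add: q_tensor_def d rst mult_ac del: fact_Suc pascal.simps)
      also have "fact (\<beta> + \<gamma> + 2) * fact (\<alpha> + \<beta>) * fact (\<alpha> + \<gamma>) / (fact n * fact (\<gamma> + 1) * fact (\<beta> + 1))
          = U * (ka * A\<^sup>2)"
        unfolding fact2[of "\<beta> + \<gamma>"] U_def K fact1[of \<alpha>]
        by (subst swap1[of "real \<alpha> + 1" "real \<alpha>"]) (use Suc in \<open>simp_all add: mult_ac add_ac\<close>)
      finally show ?thesis .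
    qed
    have "?P (kg * G) (q * B / w) (p * A / w)"
    proof (intro allI impI)
      fix x y z assume hyp: "kg * G * x + q * B / w * y + p * A / w * z = 0"
      \<comment> \<open>In these coordinates the mixed coefficients are 1, 1 and \<theta>. The
        diagonal ones become \<open>ka\<close>, \<open>kb\<close>, \<open>kg\<close> after two
        entries of \<open>pascal\<close> are raised to \<open>p\<^sup>2 / w\<close> and
        \<open>q\<^sup>2 / w\<close>, which only enlarges the form.\<close>
      define X Y Z where "X = p * (A * z) / w" and "Y = q * (B * y) / w" and "Z = G * x"
      have "ka * X\<^sup>2 + kb * Y\<^sup>2 + kg * Z\<^sup>2 + 2 * \<theta> * X * Y + 2 * X * Z + 2 * Y * Z \<le> 0"
        unfolding ka_def kb_def kg_def \<kappa>_def of_nat_add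
        by (rule kappa_form_nonpos) (use \<theta> hyp in \<open>simp_all add: X_def Y_def Z_def kg_def \<kappa>_def mult_ac\<close>)
      hence "w * (ka * X\<^sup>2 + kb * Y\<^sup>2 + kg * Z\<^sup>2 + 2 * \<theta> * X * Y + 2 * X * Z + 2 * Y * Z) \<le> 0"
        using w by (simp add: mult_le_0_iff)
      moreover have "w * (ka * X\<^sup>2) = ka * (p\<^sup>2 / w) * (A * z)\<^sup>2"
        using w by (simp add: X_def power2_eq_square)
      moreover have "w * (kb * Y\<^sup>2) = kb * (q\<^sup>2 / w) * (B * y)\<^sup>2"
        using w by (simp add: Y_def power2_eq_square)
      moreover have "w * (kg * Z\<^sup>2) = kg * w * (G * x)\<^sup>2" by (simp add: Z_def)
      moreover have "w * (2 * \<theta> * X * Y) = 2 * (p + q) * (A * z) * (B * y)"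
        using w pq by (simp add: X_def Y_def \<theta>_def)
      moreover have "w * (2 * X * Z) = 2 * p * (A * z) * (G * x)" "w * (2 * Y * Z) = 2 * q * (B * y) * (G * x)"
        using w by (simp_all add: X_def Y_def Z_def)
      ultimately have F: "ka * (p\<^sup>2 / w) * (A * z)\<^sup>2 + kb * (q\<^sup>2 / w) * (B * y)\<^sup>2 + kg * w * (G * x)\<^sup>2
        + 2 * (p + q) * (A * z) * (B * y) + 2 * p * (A * z) * (G * x) + 2 * q * (B * y) * (G * x) \<le> 0"
        by (simp only: distrib_left)
      \<comment> \<open>At \<open>\<alpha> = 0\<close> the truncated \<open>\<alpha> - 1\<close>
        names a wrong entry, which is harmless because \<open>ka = 0\<close>.\<close>
      have "ka * pascal a (\<gamma> + 1) (\<alpha> - 1) \<le> ka * (p\<^sup>2 / w)"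
      proof (cases "\<alpha> = 0")
        case False
        thus ?thesis using w4 w kpos by (intro mult_left_mono) (simp_all add: field_simps del: pascal.simps)
      qed (simp add: ka_def \<kappa>_def)
      hence le1: "ka * pascal a (\<gamma> + 1) (\<alpha> - 1) * (A * z)\<^sup>2 \<le> ka * (p\<^sup>2 / w) * (A * z)\<^sup>2"
        by (rule mult_right_mono) simp
      have "kb * pascal a (\<gamma> + 1) (\<alpha> + 1) \<le> kb * (q\<^sup>2 / w)"
        using w3 w kpos by (intro mult_left_mono) (simp_all add: field_simps del: pascal.simps)
      hence le2: "kb * pascal a (\<gamma> + 1) (\<alpha> + 1) * (B * y)\<^sup>2 \<le> kb * (q\<^sup>2 / w) * (B * y)\<^sup>2"
        by (rule mult_right_mono) simp
      have "U * (kg * w * (G * x)\<^sup>2 + kb * pascal a (\<gamma> + 1) (\<alpha> + 1) * (B * y)\<^sup>2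
        + ka * pascal a (\<gamma> + 1) (\<alpha> - 1) * (A * z)\<^sup>2
        + 2 * q * (B * y) * (G * x) + 2 * p * (A * z) * (G * x) + 2 * (p + q) * (A * z) * (B * y)) \<le> 0"
        using F le1 le2 U by (intro mult_nonneg_nonpos) linarith+
      thus "q_tensor d a (r + 2) s t * x\<^sup>2 + q_tensor d a r (s + 2) t * y\<^sup>2 + q_tensor d a r s (t + 2) * z\<^sup>2
        + 2 * q_tensor d a (r + 1) (s + 1) t * x * y + 2 * q_tensor d a (r + 1) s (t + 1) * x * z
        + 2 * q_tensor d a r (s + 1) (t + 1) * y * z \<le> 0"
        unfolding e1 e2 e3 e4 e5 e6
        by (simp only: distrib_left distrib_right power_mult_distrib mult_ac add_ac)
    qed
    thus ?thesis by blast
  qed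
qed

section \<open>The five variables and the tensor of the product form\<close>

datatype idx = IR | IS | IT | IX | IY

lemma UNIV_idx: "UNIV = {IR, IS, IT, IX, IY}"
  using idx.exhaust by auto

instance idx :: finite
  by standard (simp add: UNIV_idx)

lemma sum_idx: "(\<Sum>i\<in>UNIV. f i) = f IR + f IS + f IT + f IX + f IY"
  for f :: "idx \<Rightarrow> 'a::comm_monoid_add"
  by (simp add: UNIV_idx add_ac)

lemma size_idx: "size M = count M IR + count M IS + count M IT + count M IX + count M IY"
proof (induction M)
  case (add i M)
  thus ?case by (cases i) auto
qed simp

text \<open>Up to the factor \<open>d! e!\<close>, the tensor of all derivatives of order \<open>2d + e\<close> of
  \<open>F(s(r + t), t(r + s)) G(X, Y)\<close>; a multiset of indices records which variables are differentiated.\<close>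

definition pair_tensor ::
  "nat \<Rightarrow> (nat \<Rightarrow> real) \<Rightarrow> nat \<Rightarrow> (nat \<Rightarrow> real) \<Rightarrow> idx multiset \<Rightarrow> real" where
  "pair_tensor d a e b M =
     q_tensor d a (count M IR) (count M IS) (count M IT) *
     (if count M IX + count M IY = e then b (count M IX) else 0)"

text \<open>The multisets that extend to a nonzero derivative of top order: F(s(r + t), t(r + s))
  has degree \<open>d\<close> in each of r, s, t and \<open>2 * d\<close> in total, and G has degree
  \<open>e\<close>.\<close>

definition pair_support :: "nat \<Rightarrow> nat \<Rightarrow> idx multiset \<Rightarrow> bool" where
  "pair_support d e M \<longleftrightarrow>
     count M IR \<le> d \<and> count M IS \<le> d \<and> count M IT \<le> d \<and>
     count M IR + count M IS + count M IT \<le> 2 * d \<and> count M IX + count M IY \<le> e"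

text \<open>While neither factor is fully differentiated, each admissible r, s or t is joined to X
  and to Y, so everything connects through \<open>IX\<close>. If one factor is exhausted, any two
  distinct admissible variables of the other are adjacent, as at least two of its derivatives are
  left.\<close>

lemma connected_support_pair: "connected_support (pair_support d e) (2 * d + e)"
proof
  fix i M assume "pair_support d e (add_mset i M)"
  thus "pair_support d e M" by (cases i) (auto simp: pair_support_def)
next
  fix M assume M: "pair_support d e M" "size M < 2 * d + e"
  show "\<exists>i. pair_support d e (add_mset i M)"
  proof (cases "count M IX + count M IY < e")
    case True
    hence "pair_support d e (add_mset IX M)" using M by (simp add: pair_support_def)
    thus ?thesis by blast
  next
    case False
    hence lt: "count M IR + count M IS + count M IT < 2 * d"
      using M by (simp add: pair_support_def size_idx)
    then consider "count M IR < d" | "count M IS < d" | "count M IT < d" by linarith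
    thus ?thesis
    proof cases
      case 1
      hence "pair_support d e (add_mset IR M)" using M lt by (simp add: pair_support_def)
      thus ?thesis by blast
    next
      case 2
      hence "pair_support d e (add_mset IS M)" using M lt by (simp add: pair_support_def)
      thus ?thesis by blast
    next
      case 3
      hence "pair_support d e (add_mset IT M)" using M lt by (simp add: pair_support_def)
      thus ?thesis by blast
    qed
  qed
next
  fix M and u :: "idx \<Rightarrow> real" and j k
  assume M: "pair_support d e M" "size M + 3 \<le> 2 * d + e"
    and u: "\<And>j k. pair_support d e (add_mset j (add_mset k M)) \<Longrightarrow> u j = u k"
    and j: "pair_support d e (add_mset j M)" and k: "pair_support d e (add_mset k M)"
  define q g where "q = count M IR + count M IS + count M IT" and "g = count M IX + count M IY"
  have qg: "q + g + 3 \<le> 2 * d + e" "q \<le> 2 * d" "g \<le> e"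
    using M by (simp_all add: q_def g_def size_idx pair_support_def)
  have cross: "u i = u l" if "i \<in> {IR, IS, IT}" "l \<in> {IX, IY}"
    "pair_support d e (add_mset i M)" "pair_support d e (add_mset l M)" for i l
    by (rule u) (use that in \<open>auto simp: pair_support_def\<close>)
  have Q: "\<exists>i\<in>{IR, IS, IT}. pair_support d e (add_mset i M)" if lt: "q < 2 * d"
  proof -
    consider "count M IR < d" | "count M IS < d" | "count M IT < d" using lt q_def by linarith
    thus ?thesis using lt M by cases (auto simp: q_def pair_support_def)
  qed
  consider "g = e" | "q = 2 * d" | "g < e" "q < 2 * d" using qg by linarith
  thus "u j = u k"
  proof cases
    case 1
    have "l \<in> {IR, IS, IT}" if "pair_support d e (add_mset l M)" for l
      using 1 that by (cases l) (simp_all add: g_def pair_support_def)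
    hence "j \<in> {IR, IS, IT}" "k \<in> {IR, IS, IT}" using j k by blast+
    moreover have "q + 2 \<le> 2 * d" using 1 qg by linarith
    ultimately have "j = k \<or> pair_support d e (add_mset j (add_mset k M))"
      using j k unfolding q_def pair_support_def by (cases j; cases k; simp)
    thus ?thesis using u by blast
  next
    case 2
    have "l \<in> {IX, IY}" if "pair_support d e (add_mset l M)" for l
      using 2 that by (cases l) (simp_all add: q_def pair_support_def)
    hence "j \<in> {IX, IY}" "k \<in> {IX, IY}" using j k by blast+
    moreover have "g + 2 \<le> e" using 2 qg by linarith
    ultimately have "pair_support d e (add_mset j (add_mset k M))"
      using j k unfolding g_def pair_support_def by (cases j; cases k; simp)
    thus ?thesis using u by blast
  next
    case 3
    have X: "pair_support d e (add_mset IX M)" using 3 M by (simp add: g_def pair_support_def)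
    have hub: "u l = u IX" if l: "pair_support d e (add_mset l M)" for l
    proof (cases "l \<in> {IR, IS, IT}")
      case True
      thus ?thesis using cross[of l IX] l X by blast
    next
      case False
      hence l': "l \<in> {IX, IY}" by (cases l) auto
      obtain i where "i \<in> {IR, IS, IT}" "pair_support d e (add_mset i M)" using Q 3 by blast
      thus ?thesis using cross[of i l] cross[of i IX] l l' X by auto
    qed
    show ?thesis using hub[OF j] hub[OF k] by simp
  qed
qed

text \<open>The cases record how the last two derivatives split between the factors. Both on F: the
  ternary forms above. One on each: a product of two linear forms, zero on the kernel of the second.
  Both on G: a binary form governed by log-concavity of \<open>b\<close>.\<close>

lemma lorentzian_tensor_pair:
  assumes a: "\<And>i. a i > 0" "\<And>i. a i * a (i + 2) \<le> (a (i + 1))\<^sup>2"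
    and b: "\<And>i. b i > 0" "\<And>i. b i * b (i + 2) \<le> (b (i + 1))\<^sup>2"
  shows "lorentzian_tensor (pair_support d e) (2 * d + e) (pair_tensor d a e b)"
proof -
  let ?f = "pair_tensor d a e b"
  have qnn: "q_tensor d a r s t \<ge> 0" for r s t
    using pascal_pos[of a, OF a(1)] by (simp add: q_tensor_def less_imp_le)
  have qpos: "q_tensor d a r s t > 0 \<longleftrightarrow> r \<le> d \<and> s \<le> d \<and> t \<le> d \<and> r + s + t = 2 * d" for r s t
    using pascal_pos[of a, OF a(1)] by (auto simp: q_tensor_def)
  have nn: "?f M \<ge> 0" for M
    unfolding pair_tensor_def using qnn b(1) by (simp add: less_imp_le)
  have pos: "?f M > 0 \<longleftrightarrow> pair_support d e M \<and> size M = 2 * d + e" for M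
  proof -
    have "?f M > 0 \<longleftrightarrow> q_tensor d a (count M IR) (count M IS) (count M IT) > 0 \<and> count M IX + count M IY = e"
      unfolding pair_tensor_def using b(1)[of "count M IX"] by (auto simp: zero_less_mult_iff)
    thus ?thesis by (auto simp: qpos pair_support_def size_idx)
  qed
  have "lorentzian (\<lambda>i j. ?f (add_mset i (add_mset j M)))" if M: "size M + 2 = 2 * d + e" for M
  proof -
    define r s t x y where "r = count M IR" and "s = count M IS" and "t = count M IT"
      and "x = count M IX" and "y = count M IY"
    have sz: "r + s + t + x + y + 2 = 2 * d + e"
      using M by (simp add: size_idx r_def s_def t_def x_def y_def)
    define F where "F = (\<lambda>i j. ?f (add_mset i (add_mset j M)))"
    have Fsym: "F i j = F j i" for i j by (simp add: F_def add_mset_commute)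
    note cnt = r_def[symmetric] s_def[symmetric] t_def[symmetric] x_def[symmetric] y_def[symmetric]
    consider "x + y = e" "r + s + t + 2 = 2 * d" | "x + y + 1 = e" "r + s + t + 1 = 2 * d"
      | "x + y + 2 = e" "r + s + t = 2 * d" | "x + y > e \<or> r + s + t > 2 * d"
      using sz by linarith
    hence "lorentzian F"
    proof cases
      case 1
      obtain c\<^sub>1 c\<^sub>2 c\<^sub>3 where c: "\<And>u v w. c\<^sub>1 * u + c\<^sub>2 * v + c\<^sub>3 * w = (0::real) \<Longrightarrow>
        q_tensor d a (r + 2) s t * u\<^sup>2 + q_tensor d a r (s + 2) t * v\<^sup>2 + q_tensor d a r s (t + 2) * w\<^sup>2
        + 2 * q_tensor d a (r + 1) (s + 1) t * u * v + 2 * q_tensor d a (r + 1) s (t + 1) * u * w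
        + 2 * q_tensor d a r (s + 1) (t + 1) * v * w \<le> 0"
        using q_tensor_quadratic_nonpos[OF a 1(2)] by blast
      define c where "c = case_idx c\<^sub>1 c\<^sub>2 c\<^sub>3 (0::real) 0"
      show ?thesis
      proof (rule lorentzian_if_nonpos_on_hyperplane[of F c, OF Fsym])
        fix v assume "(\<Sum>i\<in>UNIV. c i * v i) = 0"
        hence "c\<^sub>1 * v IR + c\<^sub>2 * v IS + c\<^sub>3 * v IT = 0" by (simp add: sum_idx c_def)
        from c[OF this] have "b x * (q_tensor d a (r + 2) s t * (v IR)\<^sup>2 + q_tensor d a r (s + 2) t * (v IS)\<^sup>2
          + q_tensor d a r s (t + 2) * (v IT)\<^sup>2
          + 2 * q_tensor d a (r + 1) (s + 1) t * v IR * v IS + 2 * q_tensor d a (r + 1) s (t + 1) * v IR * v IT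
          + 2 * q_tensor d a r (s + 1) (t + 1) * v IS * v IT) \<le> 0" (is "?B \<le> 0")
          using b(1)[of x] by (intro mult_nonneg_nonpos) auto
        also have "?B = bil F v v"
          unfolding bil_def sum_idx F_def pair_tensor_def
          by (simp add: cnt 1(1) algebra_simps power2_eq_square)
        finally show "bil F v v \<le> 0" .
      qed
    next
      case 2
      have z: "q_tensor d a r' s' t' = 0" if "r' + s' + t' \<noteq> 2 * d" for r' s' t'
        using that by (auto simp: q_tensor_def)
      define c where "c = case_idx 0 0 0 (b (x + 1)) (b x)"
      show ?thesis
      proof (rule lorentzian_if_nonpos_on_hyperplane[of F c, OF Fsym])
        fix v assume "(\<Sum>i\<in>UNIV. c i * v i) = 0"
        hence h: "b (x + 1) * v IX + b x * v IY = 0" by (simp add: sum_idx c_def)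
        have "bil F v v = 2 * (q_tensor d a (r + 1) s t * v IR + q_tensor d a r (s + 1) t * v IS
            + q_tensor d a r s (t + 1) * v IT) * (b (x + 1) * v IX + b x * v IY)"
          unfolding bil_def sum_idx F_def pair_tensor_def
          using 2 by (simp add: cnt z algebra_simps)
        thus "bil F v v \<le> 0" unfolding h by simp
      qed
    next
      case 3
      have z: "q_tensor d a r' s' t' = 0" if "r' + s' + t' \<noteq> 2 * d" for r' s' t'
        using that by (auto simp: q_tensor_def)
      define c where "c = case_idx 0 0 0 (b (x + 1)) (b x)"
      show ?thesis
      proof (rule lorentzian_if_nonpos_on_hyperplane[of F c, OF Fsym])
        fix v assume "(\<Sum>i\<in>UNIV. c i * v i) = 0"
        hence h: "b (x + 1) * v IX + b x * v IY = 0" by (simp add: sum_idx c_def)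
        have "bil F v v = q_tensor d a r s t * (b (x + 2) * (v IX)\<^sup>2 + b x * (v IY)\<^sup>2
            + 2 * b (x + 1) * v IX * v IY)"
          unfolding bil_def sum_idx F_def pair_tensor_def
          using 3 by (simp add: cnt z algebra_simps power2_eq_square)
        also have "\<dots> \<le> 0"
          using b(1)[of x] b(2)[of x] h qnn
          by (intro mult_nonneg_nonpos binary_form_nonpos) (auto simp: mult_ac)
        finally show "bil F v v \<le> 0" .
      qed
    next
      case 4
      have "F i j = 0" for i j
        using 4 unfolding F_def pair_tensor_def
        by (cases i; cases j) (auto simp: cnt q_tensor_def)
      thus ?thesis by (simp add: lorentzian_def bil_def)
    qed
    thus ?thesis by (simp add: F_def)
  qed
  thus ?thesis using nn pos by (simp add: lorentzian_tensor_def)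
qed

section \<open>Products of shifted binomial coefficients\<close>

text \<open>The guard is needed because natural subtraction would turn negative lower indices into 0.\<close>

definition hadamard_coeff :: "nat \<Rightarrow> nat \<Rightarrow> nat \<Rightarrow> nat \<Rightarrow> nat \<Rightarrow> nat" where
  "hadamard_coeff d i e j k =
     (if i \<le> k \<and> j \<le> k then ((d + j - i) choose (k - i)) * ((e + i - j) choose (k - j)) else 0)"

lemma real_binomial_upper_Suc: "(real n + 1 - real k) * real (Suc n choose k) = (real n + 1) * real (n choose k)"
proof (cases "k \<le> Suc n")
  case True
  have "(Suc n - k) * (Suc n choose k) = Suc n * (n choose k)"
    using binomial_absorb_comp[of "Suc n" k] by simp
  hence "real ((Suc n - k) * (Suc n choose k)) = real (Suc n * (n choose k))" by (simp only:)
  thus ?thesis unfolding of_nat_mult of_nat_diff[OF True] by (simp add: add_ac)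
qed (simp add: not_le binomial_eq_0)

lemma real_binomial_lower_Suc: "(real k + 1) * real (n choose Suc k) = (real n - real k) * real (n choose k)"
proof -
  have "(real k + 1) * real (n choose Suc k) + (real k + 1) * real (n choose k) = (real n + 1) * real (n choose k)"
  proof -
    have "real (Suc k * (Suc n choose Suc k)) = real (Suc n * (n choose k))" by (simp only: Suc_times_binomial)
    thus ?thesis by (simp add: algebra_simps)
  qed
  thus ?thesis by (simp add: algebra_simps)
qed

text \<open>A linear factor takes an element of the shifted binomial basis in degree
  \<open>m\<close> to two neighbours in degree \<open>m + 1\<close>; products are built up by such
  factors.\<close>

lemma linear_times_shifted_binomial:
  fixes c :: real
  assumes "k \<le> m"
  shows "(real n + c) * real ((n + m - k) choose m) =
    (c + real k) * real ((n + Suc m - k) choose Suc m) + (real m + 1 - c - real k) * real ((n + Suc m - Suc k) choose Suc m)"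
proof -
  define N where "N = n + m - k"
  have N: "n + Suc m - k = Suc N" "n + Suc m - Suc k = N" "real N = real n + real m - real k"
    using assms by (simp_all add: N_def of_nat_diff Suc_diff_le)
  have 1: "(real m + 1) * real (N choose Suc m) = (real N - real m) * real (N choose m)"
    by (rule real_binomial_lower_Suc)
  have 2: "(real m + 1) * real (Suc N choose Suc m) = (real N + 1) * real (N choose m)"
    using 1 by (simp add: algebra_simps)
  have "(real m + 1) * ((c + real k) * real (Suc N choose Suc m) + (real m + 1 - c - real k) * real (N choose Suc m)) =
      (c + real k) * ((real m + 1) * real (Suc N choose Suc m)) + (real m + 1 - c - real k) * ((real m + 1) * real (N choose Suc m))"
    by (simp only: algebra_simps)
  also have "\<dots> = (real m + 1) * ((real n + c) * real (N choose m))"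
    unfolding 1 2 N(3) by (simp add: algebra_simps)
  finally show ?thesis unfolding N_def[symmetric] N(1,2) by simp
qed

text \<open>The recurrence that \<open>linear_times_shifted_binomial\<close> dictates for
  \<open>c = d + 1 - i\<close>, the factor that raises \<open>d\<close> and keeps
  \<open>i\<close>.\<close>

lemma hadamard_coeff_step_same:
  assumes "i \<le> d" "j \<le> e"
  shows "(real d + 1) * real (hadamard_coeff (Suc d) i e j k) =
    (real d + 1 - real i + real k) * real (hadamard_coeff d i e j k) +
    (if k = 0 then 0 else (real e + real i + 1 - real k) * real (hadamard_coeff d i e j (k - 1)))"
proof (cases "i \<le> k \<and> j \<le> k")
  case False
  thus ?thesis by (auto simp: hadamard_coeff_def)
next
  case True
  define A B x l where "A = d + j - i" and "B = e + i - j" and "x = k - i" and "l = k - j"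
  have r: "real A = real d + real j - real i" "real B = real e + real i - real j"
    "real x = real k - real i" "real l = real k - real j"
    using assms True by (auto simp: A_def B_def x_def l_def of_nat_diff)
  have A': "Suc d + j - i = Suc A" using assms by (simp add: A_def)
  have h1: "real (hadamard_coeff (Suc d) i e j k) = real (Suc A choose x) * real (B choose l)"
    unfolding hadamard_coeff_def A' using True by (simp add: B_def x_def l_def)
  have h2: "real (hadamard_coeff d i e j k) = real (A choose x) * real (B choose l)"
    using True by (simp add: hadamard_coeff_def A_def B_def x_def l_def)
  have h3: "(if k = 0 then 0 else (real e + real i + 1 - real k) * real (hadamard_coeff d i e j (k - 1))) =
      (if x = 0 \<or> l = 0 then 0 else (real B + 1 - real l) * (real (A choose (x - 1)) * real (B choose (l - 1))))"
  proof (cases "x = 0 \<or> l = 0")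
    case True
    thus ?thesis using \<open>i \<le> k \<and> j \<le> k\<close> by (auto simp: hadamard_coeff_def x_def l_def)
  next
    case False
    hence "i \<le> k - 1" "j \<le> k - 1" "k \<noteq> 0" "k - 1 - i = x - 1" "k - 1 - j = l - 1" by (auto simp: x_def l_def)
    moreover have "real e + real i + 1 - real k = real B + 1 - real l" using r by simp
    ultimately show ?thesis using False by (simp add: hadamard_coeff_def A_def[symmetric] B_def[symmetric])
  qed
  have up: "(real A + 1 - real x) * real (Suc A choose x) = (real A + 1) * real (A choose x)"
    by (rule real_binomial_upper_Suc)
  have "(real A + 1 - real x + real l) * (real (Suc A choose x) * real (B choose l)) =
      (real A + 1 + real l) * (real (A choose x) * real (B choose l)) +
      (if x = 0 \<or> l = 0 then 0 else (real B + 1 - real l) * (real (A choose (x - 1)) * real (B choose (l - 1))))"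
  proof (cases "x = 0 \<or> l = 0")
    case True
    thus ?thesis using up by auto
  next
    case False
    then obtain x' l' where xl: "x = Suc x'" "l = Suc l'" by (metis not0_implies_Suc)
    have lo: "(real B + 1 - real l) * real (B choose (l - 1)) = real l * real (B choose l)"
      using real_binomial_lower_Suc[of l' B] by (simp add: xl algebra_simps)
    have "(real A + 1 - real x + real l) * (real (Suc A choose x) * real (B choose l)) =
        ((real A + 1 - real x) * real (Suc A choose x) + real l * real (Suc A choose x)) * real (B choose l)"
      by (simp only: algebra_simps)
    also have "\<dots> = ((real A + 1) * real (A choose x) + real l * (real (A choose x) + real (A choose (x - 1)))) * real (B choose l)"
      unfolding up by (simp add: xl)
    also have "\<dots> = (real A + 1 + real l) * (real (A choose x) * real (B choose l)) +
        real (A choose (x - 1)) * (real l * real (B choose l))"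
      by (simp only: algebra_simps)
    also have "\<dots> = (real A + 1 + real l) * (real (A choose x) * real (B choose l)) +
        (real B + 1 - real l) * (real (A choose (x - 1)) * real (B choose (l - 1)))"
      unfolding lo[symmetric] by (simp only: mult_ac)
    finally show ?thesis using False by simp
  qed
  thus ?thesis unfolding h1 h2 h3 by (simp add: r)
qed

text \<open>Counterpart for \<open>c = - i\<close>, the factor that raises both \<open>d\<close> and
  \<open>i\<close>.\<close>

lemma hadamard_coeff_step_Suc:
  assumes "i \<le> d" "j \<le> e"
  shows "(real d + 1) * real (hadamard_coeff (Suc d) (Suc i) e j k) =
    (real k - real i) * real (hadamard_coeff d i e j k) +
    (if k = 0 then 0 else (real d + real e + 2 + real i - real k) * real (hadamard_coeff d i e j (k - 1)))"
proof (cases "Suc i \<le> k \<and> j \<le> k")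
  case False
  thus ?thesis by (cases "i = k") (auto simp: hadamard_coeff_def)
next
  case True
  define A B x l where "A = d + j - i" and "B = e + i - j" and "x = k - Suc i" and "l = k - j"
  have r: "real A = real d + real j - real i" "real B = real e + real i - real j"
    "real x = real k - real i - 1" "real l = real k - real j"
    using assms True by (auto simp: A_def B_def x_def l_def of_nat_diff)
  have AB: "Suc d + j - Suc i = A" "e + Suc i - j = Suc B" "k - i = Suc x"
    using assms True by (auto simp: A_def B_def x_def)
  have h1: "real (hadamard_coeff (Suc d) (Suc i) e j k) = real (A choose x) * real (Suc B choose l)"
    unfolding hadamard_coeff_def AB using True by (simp add: x_def l_def)
  have h2: "real (hadamard_coeff d i e j k) = real (A choose Suc x) * real (B choose l)"
    unfolding hadamard_coeff_def AB using True by (simp add: A_def B_def l_def)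
  have h3: "(if k = 0 then 0 else (real d + real e + 2 + real i - real k) * real (hadamard_coeff d i e j (k - 1))) =
      (if l = 0 then 0 else (real d + 1 + (real B + 1 - real l)) * (real (A choose x) * real (B choose (l - 1))))"
  proof (cases "l = 0")
    case True
    thus ?thesis using \<open>Suc i \<le> k \<and> j \<le> k\<close> by (auto simp: hadamard_coeff_def l_def)
  next
    case False
    hence "i \<le> k - 1" "j \<le> k - 1" "k \<noteq> 0" "k - 1 - i = x" "k - 1 - j = l - 1"
      using True by (auto simp: x_def l_def)
    moreover have "real d + real e + 2 + real i - real k = real d + 1 + (real B + 1 - real l)" using r by simp
    ultimately show ?thesis using False by (simp add: hadamard_coeff_def A_def[symmetric] B_def[symmetric])
  qed
  have lo: "(real x + 1) * real (A choose Suc x) = (real A - real x) * real (A choose x)"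
    by (rule real_binomial_lower_Suc)
  have kx: "real k - real i = real x + 1" and Ax: "real A - real x = real d + 1 - real l" using r by auto
  have "(real d + 1) * (real (A choose x) * real (Suc B choose l)) =
      (real d + 1 - real l) * real (A choose x) * real (B choose l) +
      (if l = 0 then 0 else (real d + 1 + (real B + 1 - real l)) * (real (A choose x) * real (B choose (l - 1))))"
  proof (cases l)
    case (Suc l')
    have "(real B + 1 - real l) * real (B choose (l - 1)) = real l * real (B choose l)"
      using real_binomial_lower_Suc[of l' B] by (simp add: Suc algebra_simps)
    hence "(real d + 1 + (real B + 1 - real l)) * (real (A choose x) * real (B choose (l - 1))) =
        real (A choose x) * ((real d + 1) * real (B choose (l - 1)) + real l * real (B choose l))"
      by (simp only: distrib_right distrib_left) (simp only: mult_ac)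
    thus ?thesis by (simp add: Suc algebra_simps)
  qed simp
  thus ?thesis unfolding h1 h2 h3 kx by (simp only: lo[unfolded Ax] mult.assoc[symmetric])
qed

lemma hadamard_coeff_eq_0: "j \<le> e \<Longrightarrow> d + e < k \<Longrightarrow> i \<le> d \<Longrightarrow> hadamard_coeff d i e j k = 0"
  by (auto simp: hadamard_coeff_def)

text \<open>Both indices \<open>(d + 1, i)\<close> and \<open>(d + 1, i + 1)\<close> are reached from \<open>(d, i)\<close> by multiplying with a
  linear factor in \<open>n\<close>, which gives an induction on \<open>d\<close>.\<close>

lemma binomial_product_expansion:
  assumes "i \<le> d" "j \<le> e"
  shows "real ((n + d - i) choose d) * real ((n + e - j) choose e) =
    (\<Sum>k\<le>d + e. real (hadamard_coeff d i e j k) * real ((n + (d + e) - k) choose (d + e)))"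
  using assms(1)
proof (induction d arbitrary: i)
  case 0
  have "real (hadamard_coeff 0 0 e j k) = (if k = j then 1 else 0)" for k
    by (auto simp: hadamard_coeff_def)
  thus ?case using 0 assms by (simp add: if_distrib[of "\<lambda>z. z * _"] cong: if_cong)
next
  case (Suc d)
  define m where "m = d + e"
  have key: "real ((n + Suc d - i) choose Suc d) * real ((n + e - j) choose e) =
      (\<Sum>k\<le>Suc m. real (hadamard_coeff (Suc d) i e j k) * real ((n + Suc m - k) choose Suc m))"
    if i': "i' \<le> d"
      and c: "(real n + c) * real ((n + d - i') choose d) = (real d + 1) * real ((n + Suc d - i) choose Suc d)"
      and H: "\<And>k. (real d + 1) * real (hadamard_coeff (Suc d) i e j k) =
        (c + real k) * real (hadamard_coeff d i' e j k) +
        (if k = 0 then 0 else (real m + 2 - c - real k) * real (hadamard_coeff d i' e j (k - 1)))"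
    for i' c
  proof -
    define h where "h k = real (hadamard_coeff d i' e j k)" for k
    define B where "B k = real ((n + Suc m - k) choose Suc m)" for k
    have "(real d + 1) * (real ((n + Suc d - i) choose Suc d) * real ((n + e - j) choose e)) =
        (real n + c) * (real ((n + d - i') choose d) * real ((n + e - j) choose e))"
      using c by (simp only: mult.assoc[symmetric])
    also have "\<dots> = (\<Sum>k\<le>m. h k * ((real n + c) * real ((n + m - k) choose m)))"
      unfolding Suc.IH[OF i'] sum_distrib_left h_def m_def by (simp only: mult_ac)
    also have "\<dots> = (\<Sum>k\<le>m. h k * ((c + real k) * B k + (real m + 1 - c - real k) * B (Suc k)))"
      unfolding B_def by (intro sum.cong refl) (simp only: linear_times_shifted_binomial atMost_iff)
    also have "\<dots> = (\<Sum>k\<le>m. (c + real k) * h k * B k) + (\<Sum>k\<le>m. (real m + 1 - c - real k) * h k * B (Suc k))"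
      unfolding sum.distrib[symmetric] by (intro sum.cong refl) (simp add: algebra_simps)
    also have "(\<Sum>k\<le>m. (c + real k) * h k * B k) = (\<Sum>k\<le>Suc m. (c + real k) * h k * B k)"
      using hadamard_coeff_eq_0[OF assms(2), of d "Suc m" i'] i' by (simp add: h_def m_def)
    also have "(\<Sum>k\<le>m. (real m + 1 - c - real k) * h k * B (Suc k)) =
        (\<Sum>k\<le>Suc m. (if k = 0 then 0 else (real m + 2 - c - real k) * h (k - 1)) * B k)"
      by (subst sum.atMost_Suc_shift) (simp add: algebra_simps)
    also have "(\<Sum>k\<le>Suc m. (c + real k) * h k * B k) +
        (\<Sum>k\<le>Suc m. (if k = 0 then 0 else (real m + 2 - c - real k) * h (k - 1)) * B k) =
        (real d + 1) * (\<Sum>k\<le>Suc m. real (hadamard_coeff (Suc d) i e j k) * B k)"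
      unfolding sum.distrib[symmetric] sum_distrib_left mult.assoc[symmetric] H h_def
      by (intro sum.cong refl) (simp only: distrib_right)
    finally show ?thesis unfolding B_def by simp
  qed
  show ?case
  proof (cases "i \<le> d")
    case True
    have "real ((n + Suc d - i) choose Suc d) * real ((n + e - j) choose e) =
        (\<Sum>k\<le>Suc m. real (hadamard_coeff (Suc d) i e j k) * real ((n + Suc m - k) choose Suc m))"
    proof (rule key[of i "real d + 1 - real i"])
      show "(real n + (real d + 1 - real i)) * real ((n + d - i) choose d) =
          (real d + 1) * real ((n + Suc d - i) choose Suc d)"
        using True real_binomial_lower_Suc[of d "n + d - i"]
        by (simp add: Suc_diff_le of_nat_diff algebra_simps)
    next
      fix k
      show "(real d + 1) * real (hadamard_coeff (Suc d) i e j k) =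
        (real d + 1 - real i + real k) * real (hadamard_coeff d i e j k) +
        (if k = 0 then 0 else (real m + 2 - (real d + 1 - real i) - real k) * real (hadamard_coeff d i e j (k - 1)))"
        unfolding hadamard_coeff_step_same[OF True assms(2)] by (simp add: m_def algebra_simps)
    qed (fact True)
    thus ?thesis by (simp add: m_def)
  next
    case False
    \<comment> \<open>Only \<open>i = d + 1\<close> is left, out of reach of the factor that keeps
      the index; the factor \<open>n - i'\<close> raises it from \<open>i' = d\<close>.\<close>
    then obtain i' where i': "i = Suc i'" "i' \<le> d" using Suc.prems by (cases i) auto
    have "real ((n + Suc d - i) choose Suc d) * real ((n + e - j) choose e) =
        (\<Sum>k\<le>Suc m. real (hadamard_coeff (Suc d) i e j k) * real ((n + Suc m - k) choose Suc m))"
    proof (rule key[of i' "- real i'"])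
      show "(real n + - real i') * real ((n + d - i') choose d) =
          (real d + 1) * real ((n + Suc d - i) choose Suc d)"
        using i' real_binomial_lower_Suc[of d "n + d - i'"]
        by (simp add: of_nat_diff)
    next
      fix k
      show "(real d + 1) * real (hadamard_coeff (Suc d) i e j k) =
        (- real i' + real k) * real (hadamard_coeff d i' e j k) +
        (if k = 0 then 0 else (real m + 2 - - real i' - real k) * real (hadamard_coeff d i' e j (k - 1)))"
        unfolding i'(1) hadamard_coeff_step_Suc[OF i'(2) assms(2)] by (simp add: m_def algebra_simps)
    qed (fact i')
    thus ?thesis by (simp add: m_def)
  qed
qed

section \<open>From generating functions to the shifted binomial basis\<close>

lemma times_one_minus_X_power_eq_iff:
  fixes f :: "real fps"
  assumes w: "degree w \<le> d"
  shows "f * (1 - fps_X) ^ (d + 1) = fps_of_poly w \<longleftrightarrow>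
    (\<forall>n. fps_nth f n = (\<Sum>i\<le>d. coeff w i * real ((n + d - i) choose d)))"
proof -
  define G where "G d = Abs_fps (\<lambda>n. real ((n + d) choose d))" for d
  have GX: "G d * (1 - fps_X) ^ (d + 1) = 1" for d
  proof (induction d)
    case 0
    show ?case by (rule fps_ext) (auto simp: G_def algebra_simps)
  next
    case (Suc d)
    have "G (Suc d) * (1 - fps_X) = G d"
    proof (rule fps_ext)
      fix n show "fps_nth (G (Suc d) * (1 - fps_X)) n = fps_nth (G d) n"
        by (cases n) (simp_all add: G_def algebra_simps)
    qed
    hence "G (Suc d) * (1 - fps_X) ^ (Suc d + 1) = G d * (1 - fps_X) ^ (d + 1)"
      by (metis (no_types, lifting) add_Suc mult.assoc power_Suc)
    thus ?case using Suc by (simp only:)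
  qed
  have nth: "fps_nth (fps_of_poly w * G d) n = (\<Sum>i\<le>d. coeff w i * real ((n + d - i) choose d))" for n
  proof -
    have "fps_nth (fps_of_poly w * G d) n = (\<Sum>i\<le>n. coeff w i * real ((n + d - i) choose d))"
      unfolding fps_mult_nth G_def atLeast0AtMost by (intro sum.cong refl) simp
    \<comment> \<open>Both ranges lie inside this one, where the subtraction is exact: beyond
      \<open>n\<close> the binomial is 0, beyond \<open>d\<close> the coefficient is.\<close>
    also have "\<dots> = (\<Sum>i\<le>n + d. coeff w i * real ((n + d - i) choose d))"
      by (rule sum.mono_neutral_left) auto
    also have "\<dots> = (\<Sum>i\<le>d. coeff w i * real ((n + d - i) choose d))"
      by (rule sum.mono_neutral_right) (use w in \<open>auto simp: coeff_eq_0\<close>)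
    finally show ?thesis .
  qed
  have "f * (1 - fps_X) ^ (d + 1) = fps_of_poly w \<longleftrightarrow> f = fps_of_poly w * G d"
  proof
    assume *: "f * (1 - fps_X) ^ (d + 1) = fps_of_poly w"
    show "f = fps_of_poly w * G d" unfolding *[symmetric] using GX[of d]
      by (metis mult.assoc mult.commute mult.right_neutral)
  next
    assume "f = fps_of_poly w * G d"
    thus "f * (1 - fps_X) ^ (d + 1) = fps_of_poly w" using GX[of d] by (simp only: mult.assoc mult_1_right)
  qed
  thus ?thesis by (simp add: fps_eq_iff nth)
qed

lemma poly_eq_W_poly_sum:
  "poly p (real n) = (\<Sum>i\<le>degree p. coeff (W_poly p) i * real ((n + degree p - i) choose degree p))"
  using values_fps_eq_W_poly[of p] times_one_minus_X_power_eq_iff[OF degree_W_poly_le, of "values_fps p" p]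
  by (simp only: eq_divide_one_minus_fps_X_power_iff values_fps_nth)

lemma coeff_W_poly_mult:
  assumes "p \<noteq> 0" "q \<noteq> 0"
  shows "coeff (W_poly (p * q)) k =
    (\<Sum>i\<le>degree p. \<Sum>j\<le>degree q. coeff (W_poly p) i * coeff (W_poly q) j *
       real (hadamard_coeff (degree p) i (degree q) j k))"
proof -
  define d e where "d = degree p" and "e = degree q"
  define c where "c k = (\<Sum>i\<le>d. \<Sum>j\<le>e. coeff (W_poly p) i * coeff (W_poly q) j * real (hadamard_coeff d i e j k))" for k
  have c0: "c k = 0" if "k > d + e" for k
    unfolding c_def using that by (intro sum.neutral ballI) (simp add: hadamard_coeff_eq_0)
  define w where "w = (\<Sum>k\<le>d + e. monom (c k) k)"
  have cw: "coeff w k = c k" for k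
    unfolding w_def by (cases "k \<le> d + e") (simp_all add: coeff_sum c0)
  have dw: "degree w \<le> d + e" using c0 cw by (intro degree_le) simp
  have dpq: "degree (p * q) = d + e" using assms by (simp add: degree_mult_eq d_def e_def)
  have "poly (p * q) (real n) = (\<Sum>k\<le>d + e. coeff w k * real ((n + (d + e) - k) choose (d + e)))" for n
  proof -
    have "poly (p * q) (real n) = (\<Sum>i\<le>d. \<Sum>j\<le>e. coeff (W_poly p) i * coeff (W_poly q) j *
        (real ((n + d - i) choose d) * real ((n + e - j) choose e)))"
      unfolding poly_mult poly_eq_W_poly_sum[of p] poly_eq_W_poly_sum[of q] d_def[symmetric] e_def[symmetric] sum_product
      by (intro sum.cong refl) (simp only: mult_ac)
    also have "\<dots> = (\<Sum>i\<le>d. \<Sum>j\<le>e. \<Sum>k\<le>d + e. coeff (W_poly p) i * coeff (W_poly q) j *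
        real (hadamard_coeff d i e j k) * real ((n + (d + e) - k) choose (d + e)))"
      by (intro sum.cong refl) (simp only: binomial_product_expansion atMost_iff sum_distrib_left mult.assoc)
    also have "\<dots> = (\<Sum>i\<le>d. \<Sum>k\<le>d + e. \<Sum>j\<le>e. coeff (W_poly p) i * coeff (W_poly q) j *
        real (hadamard_coeff d i e j k) * real ((n + (d + e) - k) choose (d + e)))"
      by (rule sum.cong[OF refl], rule sum.swap)
    also have "\<dots> = (\<Sum>k\<le>d + e. \<Sum>i\<le>d. \<Sum>j\<le>e. coeff (W_poly p) i * coeff (W_poly q) j *
        real (hadamard_coeff d i e j k) * real ((n + (d + e) - k) choose (d + e)))"
      by (rule sum.swap)
    finally show ?thesis by (simp only: cw c_def sum_distrib_right)
  qed
  hence "values_fps (p * q) * (1 - fps_X) ^ (degree (p * q) + 1) = fps_of_poly w"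
    unfolding dpq times_one_minus_X_power_eq_iff[OF dw] values_fps_nth by blast
  hence "W_poly (p * q) = w"
    by (intro W_poly_unique) (simp only: eq_divide_one_minus_fps_X_power_iff)
  thus ?thesis by (simp add: cw c_def d_def e_def)
qed

section \<open>Evaluation of the contracted tensor\<close>

text \<open>The induction step of the binomial theorem for commuting operators, shared by
  \<open>pascal_eq_sum\<close> and \<open>contract_funpow_add\<close>.\<close>

lemma binomial_sum_Suc:
  fixes g :: "nat \<Rightarrow> nat \<Rightarrow> real"
  shows "(\<Sum>l\<le>n. real (n choose l) * g (Suc l) (n - l)) + (\<Sum>l\<le>n. real (n choose l) * g l (Suc n - l)) =
    (\<Sum>l\<le>Suc n. real (Suc n choose l) * g l (Suc n - l))"
proof -
  define h where "h l = g l (Suc n - l)" for l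
  have "(\<Sum>l\<le>n. real (n choose l) * h l) = (\<Sum>l\<le>Suc n. real (n choose l) * h l)" by simp
  also have "\<dots> = h 0 + (\<Sum>l\<le>n. real (n choose Suc l) * h (Suc l))"
    by (subst sum.atMost_Suc_shift) simp
  finally have "(\<Sum>l\<le>n. real (n choose l) * h (Suc l)) + (\<Sum>l\<le>n. real (n choose l) * h l) =
      h 0 + (\<Sum>l\<le>n. real (Suc n choose Suc l) * h (Suc l))"
    by (simp add: sum.distrib[symmetric] algebra_simps)
  also have "\<dots> = (\<Sum>l\<le>Suc n. real (Suc n choose l) * h l)"
    by (subst sum.atMost_Suc_shift) simp
  finally show ?thesis by (simp add: h_def)
qed

lemma pascal_eq_sum: "pascal a n i = (\<Sum>l\<le>n. real (n choose l) * a (i + l))"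
proof (induction n arbitrary: i)
  case (Suc n)
  have "pascal a (Suc n) i = (\<Sum>l\<le>n. real (n choose l) * a (i + Suc l)) + (\<Sum>l\<le>n. real (n choose l) * a (i + l))"
    by (simp add: Suc)
  also have "\<dots> = (\<Sum>l\<le>Suc n. real (Suc n choose l) * a (i + l))"
    by (rule binomial_sum_Suc)
  finally show ?case .
qed simp

lemma contract_add_tensor:
  "contract u (\<lambda>M. f M + g M) = (\<lambda>M. contract u f M + contract u g M)"
  by (rule ext) (simp add: contract_def sum.distrib algebra_simps)

lemma contract_funpow_add_tensor:
  "(contract u ^^ n) (\<lambda>M. f M + g M) = (\<lambda>M. (contract u ^^ n) f M + (contract u ^^ n) g M)"
  by (induction n) (simp_all add: contract_add_tensor)

lemma contract_funpow_add:
  "(contract (\<lambda>i. u i + v i) ^^ n) f M =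
    (\<Sum>l\<le>n. real (n choose l) * (contract u ^^ l) ((contract v ^^ (n - l)) f) M)"
proof (induction n arbitrary: f)
  case (Suc n)
  define g where "g i j = (contract u ^^ i) ((contract v ^^ j) f) M" for i j
  have "contract (\<lambda>i. u i + v i) f = (\<lambda>M. contract u f M + contract v f M)"
    by (rule ext) (simp add: contract_def sum.distrib algebra_simps)
  hence "(contract (\<lambda>i. u i + v i) ^^ Suc n) f M =
      (contract (\<lambda>i. u i + v i) ^^ n) (contract u f) M + (contract (\<lambda>i. u i + v i) ^^ n) (contract v f) M"
    by (simp add: funpow_Suc_right contract_funpow_add_tensor del: funpow.simps)
  also have "\<dots> = (\<Sum>l\<le>n. real (n choose l) * g (Suc l) (n - l)) + (\<Sum>l\<le>n. real (n choose l) * g l (Suc n - l))"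
    unfolding Suc g_def
    by (intro arg_cong2[of _ _ _ _ "(+)"] sum.cong refl)
      (simp_all add: contract_funpow_commute[symmetric] Suc_diff_le)
  also have "\<dots> = (\<Sum>l\<le>Suc n. real (Suc n choose l) * g l (Suc n - l))" by (rule binomial_sum_Suc)
  finally show ?case by (simp only: g_def)
qed simp

lemma contract_unit_funpow:
  "(contract (\<lambda>j. if j = i then 1 else 0) ^^ n) f M = f (M + replicate_mset n i)"
proof (induction n arbitrary: M)
  case (Suc n)
  have "contract (\<lambda>j. if j = i then 1 else 0) g M = g (add_mset i M)" for g
    by (simp add: contract_def if_distrib[of "\<lambda>z. z * _"] cong: if_cong)
  thus ?case by (simp add: Suc)
qed simp

text \<open>Contracting with these directions amounts to substituting \<open>X = r + s\<close> and \<open>Y = r + t\<close> in \<open>G\<close>.\<close>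

definition vr :: "idx \<Rightarrow> real" where "vr = case_idx 1 0 0 1 1"
definition vs :: "idx \<Rightarrow> real" where "vs = case_idx 0 1 0 1 0"
definition vt :: "idx \<Rightarrow> real" where "vt = case_idx 0 0 1 0 1"

text \<open>Each direction is split into unit vectors: \<rho>, \<sigma>, \<tau> derivatives fall on
  r, s, t and the others on X and Y. Only those coming from \<open>vr\<close> can choose between X
  and Y, and summing over that choice yields \<open>pascal b\<close>.\<close>

lemma contract_pair_tensor_eq_sum:
  assumes "k \<le> d + e"
  shows "(contract vr ^^ d) ((contract vs ^^ k) ((contract vt ^^ (d + e - k)) (pair_tensor d a e b))) {#} =
    (\<Sum>\<sigma>\<le>k. \<Sum>\<tau>\<le>d + e - k. \<Sum>\<rho>\<le>d. real (d choose \<rho>) * real (k choose \<sigma>) * real ((d + e - k) choose \<tau>) *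
       q_tensor d a \<rho> \<sigma> \<tau> * pascal b (d - \<rho>) (k - \<sigma>))"
proof -
  define u where "u i = (\<lambda>j::idx. if j = i then 1 else 0 :: real)" for i
  define f where "f = pair_tensor d a e b"
  define c where "c = d + e - k"
  have vt: "vt = (\<lambda>i. u IT i + u IY i)" and vs: "vs = (\<lambda>i. u IS i + u IX i)"
    and vr: "vr = (\<lambda>i. u IR i + (\<lambda>i. u IX i + u IY i) i)"
    by (rule ext, simp add: vr_def vs_def vt_def u_def split: idx.split)+
  have uf: "(contract (u i) ^^ n) g M = g (M + replicate_mset n i)" for i n g M
    unfolding u_def by (rule contract_unit_funpow)
  have "(contract vr ^^ d) ((contract vs ^^ k) ((contract vt ^^ c) f)) {#} =
    (\<Sum>\<rho>\<le>d. real (d choose \<rho>) * (\<Sum>l\<le>d - \<rho>. real ((d - \<rho>) choose l) * (\<Sum>\<sigma>\<le>k. real (k choose \<sigma>) *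
      (\<Sum>\<tau>\<le>c. real (c choose \<tau>) * f (replicate_mset \<rho> IR + replicate_mset l IX + replicate_mset (d - \<rho> - l) IY +
        replicate_mset \<sigma> IS + replicate_mset (k - \<sigma>) IX + replicate_mset \<tau> IT + replicate_mset (c - \<tau>) IY)))))"
    unfolding vr contract_funpow_add[where u="u IR" and v="\<lambda>i. u IX i + u IY i"] uf
      contract_funpow_add[where u="u IX" and v="u IY"] vs contract_funpow_add[where u="u IS" and v="u IX"]
      vt contract_funpow_add[where u="u IT" and v="u IY"] by simp
  also have "\<dots> = (\<Sum>\<rho>\<le>d. real (d choose \<rho>) * (\<Sum>l\<le>d - \<rho>. real ((d - \<rho>) choose l) * (\<Sum>\<sigma>\<le>k. real (k choose \<sigma>) *
      (\<Sum>\<tau>\<le>c. real (c choose \<tau>) * (q_tensor d a \<rho> \<sigma> \<tau> * b (k - \<sigma> + l))))))"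
  proof (intro sum.cong refl arg_cong2[of _ _ _ _ "(*)"])
    fix \<rho> l \<sigma> \<tau> assume r: "\<rho> \<in> {..d}" "l \<in> {..d - \<rho>}" "\<sigma> \<in> {..k}" "\<tau> \<in> {..c}"
    \<comment> \<open>The total order is \<open>2 * d + e\<close>, so exponents of r, s, t with sum
      \<open>2 * d\<close>, without which \<open>q_tensor\<close> vanishes, leave exactly
      \<open>e\<close> derivatives for X and Y.\<close>
    have "q_tensor d a \<rho> \<sigma> \<tau> = 0 \<or> l + (k - \<sigma>) + (d - \<rho> - l + (c - \<tau>)) = e"
      using r assms by (auto simp: q_tensor_def c_def)
    thus "f (replicate_mset \<rho> IR + replicate_mset l IX + replicate_mset (d - \<rho> - l) IY +
        replicate_mset \<sigma> IS + replicate_mset (k - \<sigma>) IX + replicate_mset \<tau> IT + replicate_mset (c - \<tau>) IY) =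
        q_tensor d a \<rho> \<sigma> \<tau> * b (k - \<sigma> + l)"
      by (auto simp: f_def pair_tensor_def add_ac)
  qed
  also have "\<dots> = (\<Sum>\<rho>\<le>d. \<Sum>l\<le>d - \<rho>. \<Sum>\<sigma>\<le>k. \<Sum>\<tau>\<le>c. real (d choose \<rho>) * real (k choose \<sigma>) * real (c choose \<tau>) *
       q_tensor d a \<rho> \<sigma> \<tau> * (real ((d - \<rho>) choose l) * b (k - \<sigma> + l)))"
    by (simp add: sum_distrib_left mult_ac)
  also have "\<dots> = (\<Sum>\<rho>\<le>d. \<Sum>\<sigma>\<le>k. \<Sum>\<tau>\<le>c. \<Sum>l\<le>d - \<rho>. real (d choose \<rho>) * real (k choose \<sigma>) * real (c choose \<tau>) *
       q_tensor d a \<rho> \<sigma> \<tau> * (real ((d - \<rho>) choose l) * b (k - \<sigma> + l)))"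
    by (rule sum.cong[OF refl], subst sum.swap, rule sum.cong[OF refl], rule sum.swap)
  also have "\<dots> = (\<Sum>\<rho>\<le>d. \<Sum>\<sigma>\<le>k. \<Sum>\<tau>\<le>c. real (d choose \<rho>) * real (k choose \<sigma>) * real (c choose \<tau>) *
       q_tensor d a \<rho> \<sigma> \<tau> * pascal b (d - \<rho>) (k - \<sigma>))"
    unfolding pascal_eq_sum by (simp add: sum_distrib_left)
  also have "\<dots> = (\<Sum>\<sigma>\<le>k. \<Sum>\<tau>\<le>c. \<Sum>\<rho>\<le>d. real (d choose \<rho>) * real (k choose \<sigma>) * real (c choose \<tau>) *
       q_tensor d a \<rho> \<sigma> \<tau> * pascal b (d - \<rho>) (k - \<sigma>))"
    by (subst sum.swap, rule sum.cong[OF refl], rule sum.swap)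
  finally show ?thesis by (simp only: c_def f_def)
qed

text \<open>With \<open>i = \<alpha> + l\<close> the three binomials form one multinomial
  coefficient, which regroups as the factor on the left times
  \<open>\<gamma> choose l\<close>.\<close>

lemma multinomial_pascal:
  assumes "\<alpha> + \<beta> + \<gamma> = d"
  shows "fact d / (fact \<alpha> * fact \<beta> * fact \<gamma>) * pascal a \<gamma> \<alpha> =
    (\<Sum>i\<le>d. real (d choose i) * a i * real (i choose \<alpha>) * real ((d - i) choose \<beta>))"
proof -
  have "(\<Sum>i\<le>d. real (d choose i) * a i * real (i choose \<alpha>) * real ((d - i) choose \<beta>)) =
      (\<Sum>i\<in>{\<alpha>..\<alpha> + \<gamma>}. real (d choose i) * a i * real (i choose \<alpha>) * real ((d - i) choose \<beta>))"
    using assms by (intro sum.mono_neutral_right) (auto simp: not_le)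
  also have "\<dots> = (\<Sum>l\<le>\<gamma>. real (d choose (\<alpha> + l)) * a (\<alpha> + l) * real ((\<alpha> + l) choose \<alpha>) * real ((d - (\<alpha> + l)) choose \<beta>))"
    by (rule sum.reindex_bij_witness[of _ "\<lambda>l. \<alpha> + l" "\<lambda>i. i - \<alpha>"]) auto
  also have "\<dots> = (\<Sum>l\<le>\<gamma>. fact d / (fact \<alpha> * fact \<beta> * fact \<gamma>) * (real (\<gamma> choose l) * a (\<alpha> + l)))"
  proof (intro sum.cong refl)
    fix l assume "l \<in> {..\<gamma>}"
    then obtain m where m: "\<gamma> = l + m" using le_Suc_ex by auto
    have d: "d = \<alpha> + l + (\<beta> + m)" using assms m by simp
    have "real (d choose (\<alpha> + l)) = fact d / (fact (\<alpha> + l) * fact (\<beta> + m))"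
      using binomial_fact[of "\<alpha> + l" d, where 'a=real] d by simp
    moreover have "real ((\<alpha> + l) choose \<alpha>) = fact (\<alpha> + l) / (fact \<alpha> * fact l)"
      using binomial_fact[of \<alpha> "\<alpha> + l", where 'a=real] by simp
    moreover have "real ((d - (\<alpha> + l)) choose \<beta>) = fact (\<beta> + m) / (fact \<beta> * fact m)"
      using binomial_fact[of \<beta> "\<beta> + m", where 'a=real] d by simp
    moreover have "real (\<gamma> choose l) = fact \<gamma> / (fact l * fact m)"
      using binomial_fact[of l \<gamma>, where 'a=real] m by simp
    ultimately show "real (d choose (\<alpha> + l)) * a (\<alpha> + l) * real ((\<alpha> + l) choose \<alpha>) * real ((d - (\<alpha> + l)) choose \<beta>) =
      fact d / (fact \<alpha> * fact \<beta> * fact \<gamma>) * (real (\<gamma> choose l) * a (\<alpha> + l))"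
      by (simp only:) (simp add: field_simps)
  qed
  finally show ?thesis by (simp add: pascal_eq_sum sum_distrib_left)
qed

text \<open>Reflecting \<open>d - \<sigma>\<close> into \<open>\<sigma> - i\<close> gives a
  Vandermonde convolution. For \<open>\<sigma> > d\<close> the truncated \<open>d - \<sigma>\<close>
  would turn a zero binomial into 1, hence the guard.\<close>

lemma vandermonde_sigma:
  assumes "i \<le> d"
  shows "(\<Sum>\<sigma>\<le>k. if \<sigma> \<le> d then ((d - i) choose (d - \<sigma>)) * (j choose (k - \<sigma>)) else 0) =
    (if i \<le> k then (d + j - i) choose (k - i) else 0)"
proof (cases "i \<le> k")
  case True
  have "(\<Sum>\<sigma>\<le>k. if \<sigma> \<le> d then ((d - i) choose (d - \<sigma>)) * (j choose (k - \<sigma>)) else 0) =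
      (\<Sum>\<sigma>\<in>{i..k}. ((d - i) choose (\<sigma> - i)) * (j choose (k - \<sigma>)))"
  proof (rule sum.mono_neutral_cong_right)
    fix \<sigma> assume "\<sigma> \<in> {i..k}"
    thus "(if \<sigma> \<le> d then ((d - i) choose (d - \<sigma>)) * (j choose (k - \<sigma>)) else 0) =
        ((d - i) choose (\<sigma> - i)) * (j choose (k - \<sigma>))"
      using assms binomial_symmetric[of "\<sigma> - i" "d - i"] by auto
  qed (use assms in auto)
  also have "\<dots> = (\<Sum>x\<le>k - i. ((d - i) choose x) * (j choose (k - i - x)))"
    using True by (intro sum.reindex_bij_witness[of _ "\<lambda>x. x + i" "\<lambda>\<sigma>. \<sigma> - i"]) auto
  also have "\<dots> = (d - i + j) choose (k - i)" by (rule vandermonde)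
  finally show ?thesis using True assms by simp
next
  case False
  thus ?thesis using assms by (auto intro!: sum.neutral)
qed

text \<open>Here the second binomial is reflected and \<open>x = d - \<tau>\<close> becomes the
  index; terms outside the common range vanish.\<close>

lemma vandermonde_tau:
  assumes "j \<le> e" "i \<le> d" "k \<le> d + e"
  shows "(\<Sum>\<tau>\<le>d + e - k. if \<tau> \<le> d then (i choose (d - \<tau>)) * ((e - j) choose (d + e - k - \<tau>)) else 0) =
    (if j \<le> k then (e + i - j) choose (k - j) else 0)"
proof (cases "j \<le> k")
  case True
  have "(\<Sum>\<tau>\<le>d + e - k. if \<tau> \<le> d then (i choose (d - \<tau>)) * ((e - j) choose (d + e - k - \<tau>)) else 0) =
      (\<Sum>\<tau>\<in>{\<tau>. \<tau> \<le> d + e - k \<and> \<tau> \<le> d \<and> d \<le> k - j + \<tau>}. (i choose (d - \<tau>)) * ((e - j) choose (k - j - (d - \<tau>))))"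
  proof (rule sum.mono_neutral_cong_right)
    fix \<tau> assume t: "\<tau> \<in> {\<tau>. \<tau> \<le> d + e - k \<and> \<tau> \<le> d \<and> d \<le> k - j + \<tau>}"
    have "(e - j) - (d + e - k - \<tau>) = k - j - (d - \<tau>)" "d + e - k - \<tau> \<le> e - j" using t assms True by auto
    thus "(if \<tau> \<le> d then (i choose (d - \<tau>)) * ((e - j) choose (d + e - k - \<tau>)) else 0) =
        (i choose (d - \<tau>)) * ((e - j) choose (k - j - (d - \<tau>)))"
      using t binomial_symmetric[of "d + e - k - \<tau>" "e - j"] by simp
  qed (use assms True in auto)
  also have "\<dots> = (\<Sum>x\<in>{x. x \<le> k - j \<and> x \<le> d \<and> k \<le> e + x}. (i choose x) * ((e - j) choose (k - j - x)))"
    using assms True by (intro sum.reindex_bij_witness[of _ "\<lambda>x. d - x" "\<lambda>\<tau>. d - \<tau>"]) auto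
  also have "\<dots> = (\<Sum>x\<le>k - j. (i choose x) * ((e - j) choose (k - j - x)))"
    using assms True by (intro sum.mono_neutral_left) auto
  also have "\<dots> = (i + (e - j)) choose (k - j)" by (rule vandermonde)
  finally show ?thesis using True assms by (simp add: add.commute)
next
  case False
  thus ?thesis using assms by (auto intro!: sum.neutral)
qed

text \<open>The derivative is \<open>d! k! (d + e - k)!\<close> times the coefficient of r^d s^k
  t^(d+e-k), and the tensor is normalised by \<open>d! e!\<close>; this explains the prefactor. The
  sums over \<sigma> and \<tau> separate into two Vandermonde convolutions, the two factors of
  \<open>hadamard_coeff\<close>.\<close>

lemma contract_pair_tensor_value:
  assumes k: "k \<le> d + e"
  shows "(contract vr ^^ d) ((contract vs ^^ k) ((contract vt ^^ (d + e - k)) (pair_tensor d a e b))) {#} =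
    fact k * fact (d + e - k) / fact e *
    (\<Sum>i\<le>d. \<Sum>j\<le>e. (real (d choose i) * a i) * (real (e choose j) * b j) * real (hadamard_coeff d i e j k))"
proof -
  define c where "c = d + e - k"
  define h where "h i = real (d choose i) * a i" for i
  define g where "g j = real (e choose j) * b j" for j
  define C where "C = (fact k * fact c / fact e :: real)"
  define P where "P \<sigma> \<tau> i = real (i choose (d - \<tau>)) * real ((d - i) choose (d - \<sigma>))" for \<sigma> \<tau> i
  define R where "R \<sigma> \<tau> j = real (j choose (k - \<sigma>)) * real ((e - j) choose (c - \<tau>))" for \<sigma> \<tau> j
  have step: "(\<Sum>\<rho>\<le>d. real (d choose \<rho>) * real (k choose \<sigma>) * real (c choose \<tau>) *
       q_tensor d a \<rho> \<sigma> \<tau> * pascal b (d - \<rho>) (k - \<sigma>)) =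
      (if \<sigma> \<le> d \<and> \<tau> \<le> d then C * ((\<Sum>i\<le>d. h i * P \<sigma> \<tau> i) * (\<Sum>j\<le>e. g j * R \<sigma> \<tau> j)) else 0)"
    (is "?L = ?R") if st: "\<sigma> \<le> k" "\<tau> \<le> c" for \<sigma> \<tau>
  proof -
    consider "\<not> (\<sigma> \<le> d \<and> \<tau> \<le> d)" | "\<sigma> \<le> d" "\<tau> \<le> d" "\<sigma> + \<tau> < d"
      | "\<sigma> \<le> d" "\<tau> \<le> d" "d \<le> \<sigma> + \<tau>" by linarith
    thus ?thesis
    proof cases
      case 1
      thus ?thesis by (auto simp: q_tensor_def intro!: sum.neutral)
    next
      case 2
      have "P \<sigma> \<tau> i = 0" for i
      proof (cases "i < d - \<tau>")
        case False
        hence "d - i < d - \<sigma>" using 2 by linarith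
        thus ?thesis by (simp add: P_def)
      qed (simp add: P_def)
      moreover have "?L = 0" using 2 by (auto simp: q_tensor_def intro!: sum.neutral)
      ultimately show ?thesis by simp
    next
      case 3
      define \<rho> where "\<rho> = 2 * d - \<sigma> - \<tau>"
      have \<rho>: "\<rho> \<le> d" "\<rho> + \<sigma> + \<tau> = 2 * d" using 3 by (auto simp: \<rho>_def)
      have "?L = real (d choose \<rho>) * real (k choose \<sigma>) * real (c choose \<tau>) *
          q_tensor d a \<rho> \<sigma> \<tau> * pascal b (d - \<rho>) (k - \<sigma>)"
      proof -
        have "?L = (\<Sum>x\<le>d. if x = \<rho> then real (d choose \<rho>) * real (k choose \<sigma>) * real (c choose \<tau>) *
          q_tensor d a \<rho> \<sigma> \<tau> * pascal b (d - \<rho>) (k - \<sigma>) else 0)"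
          using \<rho> by (intro sum.cong refl) (auto simp: q_tensor_def)
        thus ?thesis using \<rho> by simp
      qed
      also have "\<dots> = C * ((fact d / (fact (d - \<tau>) * fact (d - \<sigma>) * fact (d - \<rho>)) * pascal a (d - \<rho>) (d - \<tau>))
          * (fact e / (fact (k - \<sigma>) * fact (c - \<tau>) * fact (d - \<rho>)) * pascal b (d - \<rho>) (k - \<sigma>)))"
        using \<rho> 3 st by (simp add: q_tensor_def C_def binomial_fact mult_ac)
      also have "fact d / (fact (d - \<tau>) * fact (d - \<sigma>) * fact (d - \<rho>)) * pascal a (d - \<rho>) (d - \<tau>)
          = (\<Sum>i\<le>d. h i * P \<sigma> \<tau> i)"
        using \<rho> 3 by (subst multinomial_pascal) (auto simp: h_def P_def mult_ac)
      also have "fact e / (fact (k - \<sigma>) * fact (c - \<tau>) * fact (d - \<rho>)) * pascal b (d - \<rho>) (k - \<sigma>)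
          = (\<Sum>j\<le>e. g j * R \<sigma> \<tau> j)"
        using \<rho> st 3 k by (subst multinomial_pascal) (auto simp: g_def R_def c_def mult_ac)
      finally show ?thesis using 3 by simp
    qed
  qed
  have "(contract vr ^^ d) ((contract vs ^^ k) ((contract vt ^^ c) (pair_tensor d a e b))) {#} =
      (\<Sum>\<sigma>\<le>k. \<Sum>\<tau>\<le>c. if \<sigma> \<le> d \<and> \<tau> \<le> d then C * ((\<Sum>i\<le>d. h i * P \<sigma> \<tau> i) * (\<Sum>j\<le>e. g j * R \<sigma> \<tau> j)) else 0)"
    unfolding c_def contract_pair_tensor_eq_sum[OF k] unfolding c_def[symmetric]
    by (intro sum.cong refl step) auto
  also have "\<dots> = (\<Sum>\<sigma>\<le>k. \<Sum>\<tau>\<le>c. \<Sum>i\<le>d. \<Sum>j\<le>e. C * (h i * g j *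
      ((if \<sigma> \<le> d then real ((d - i) choose (d - \<sigma>)) * real (j choose (k - \<sigma>)) else 0) *
       (if \<tau> \<le> d then real (i choose (d - \<tau>)) * real ((e - j) choose (c - \<tau>)) else 0))))"
    by (intro sum.cong refl) (auto simp: sum_product sum_distrib_left P_def R_def mult_ac)
  also have "\<dots> = (\<Sum>i\<le>d. \<Sum>j\<le>e. \<Sum>\<sigma>\<le>k. \<Sum>\<tau>\<le>c. C * (h i * g j *
      ((if \<sigma> \<le> d then real ((d - i) choose (d - \<sigma>)) * real (j choose (k - \<sigma>)) else 0) *
       (if \<tau> \<le> d then real (i choose (d - \<tau>)) * real ((e - j) choose (c - \<tau>)) else 0))))"
    (is "_ = (\<Sum>i\<le>d. \<Sum>j\<le>e. \<Sum>\<sigma>\<le>k. \<Sum>\<tau>\<le>c. ?T i j \<sigma> \<tau>)")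
  proof -
    have "(\<Sum>\<sigma>\<le>k. \<Sum>\<tau>\<le>c. \<Sum>i\<le>d. \<Sum>j\<le>e. ?T i j \<sigma> \<tau>) = (\<Sum>\<sigma>\<le>k. \<Sum>i\<le>d. \<Sum>\<tau>\<le>c. \<Sum>j\<le>e. ?T i j \<sigma> \<tau>)"
      by (rule sum.cong[OF refl], rule sum.swap)
    also have "\<dots> = (\<Sum>\<sigma>\<le>k. \<Sum>i\<le>d. \<Sum>j\<le>e. \<Sum>\<tau>\<le>c. ?T i j \<sigma> \<tau>)"
      by (rule sum.cong[OF refl], rule sum.cong[OF refl], rule sum.swap)
    also have "\<dots> = (\<Sum>i\<le>d. \<Sum>\<sigma>\<le>k. \<Sum>j\<le>e. \<Sum>\<tau>\<le>c. ?T i j \<sigma> \<tau>)" by (rule sum.swap)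
    also have "\<dots> = (\<Sum>i\<le>d. \<Sum>j\<le>e. \<Sum>\<sigma>\<le>k. \<Sum>\<tau>\<le>c. ?T i j \<sigma> \<tau>)"
      by (rule sum.cong[OF refl], rule sum.swap)
    finally show ?thesis .
  qed
  also have "\<dots> = (\<Sum>i\<le>d. \<Sum>j\<le>e. C * (h i * g j * real (hadamard_coeff d i e j k)))"
  proof (intro sum.cong refl)
    fix i j assume "i \<in> {..d}" "j \<in> {..e}"
    hence ij: "i \<le> d" "j \<le> e" by auto
    have s: "(\<Sum>\<sigma>\<le>k. if \<sigma> \<le> d then real ((d - i) choose (d - \<sigma>)) * real (j choose (k - \<sigma>)) else 0) =
        real (if i \<le> k then (d + j - i) choose (k - i) else 0)"
    proof -
      have "(\<Sum>\<sigma>\<le>k. if \<sigma> \<le> d then real ((d - i) choose (d - \<sigma>)) * real (j choose (k - \<sigma>)) else 0) =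
          real (\<Sum>\<sigma>\<le>k. if \<sigma> \<le> d then ((d - i) choose (d - \<sigma>)) * (j choose (k - \<sigma>)) else 0)"
        unfolding of_nat_sum by (intro sum.cong refl) simp
      thus ?thesis by (simp only: vandermonde_sigma[OF ij(1)])
    qed
    have t: "(\<Sum>\<tau>\<le>c. if \<tau> \<le> d then real (i choose (d - \<tau>)) * real ((e - j) choose (c - \<tau>)) else 0) =
        real (if j \<le> k then (e + i - j) choose (k - j) else 0)"
    proof -
      have "(\<Sum>\<tau>\<le>c. if \<tau> \<le> d then real (i choose (d - \<tau>)) * real ((e - j) choose (c - \<tau>)) else 0) =
          real (\<Sum>\<tau>\<le>c. if \<tau> \<le> d then (i choose (d - \<tau>)) * ((e - j) choose (c - \<tau>)) else 0)"
        unfolding of_nat_sum by (intro sum.cong refl) simp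
      thus ?thesis by (simp only: c_def vandermonde_tau[OF ij(2,1) k])
    qed
    show "(\<Sum>\<sigma>\<le>k. \<Sum>\<tau>\<le>c. ?T i j \<sigma> \<tau>) = C * (h i * g j * real (hadamard_coeff d i e j k))"
      unfolding sum_distrib_left[symmetric] sum_distrib_right[symmetric] s t
      by (simp add: hadamard_coeff_def)
  qed
  finally show ?thesis by (simp add: c_def C_def h_def g_def sum_distrib_left)
qed

section \<open>Ultra log-concavity of the product\<close>

text \<open>Without internal zeros the support is an interval from \<open>p\<close> to
  \<open>q\<close>, and geometric tails of ratio tending to 0 can be attached at its ends.\<close>

lemma positive_log_concave_approximation:
  fixes a :: "nat \<Rightarrow> real"
  assumes nn: "\<And>i. a i \<ge> 0" and lc: "\<And>i. a i * a (i + 2) \<le> (a (i + 1))\<^sup>2"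
    and niz: "\<And>i j k. i < j \<Longrightarrow> j < k \<Longrightarrow> a i \<noteq> 0 \<Longrightarrow> a k \<noteq> 0 \<Longrightarrow> a j \<noteq> 0"
    and fin: "\<And>i. i > d \<Longrightarrow> a i = 0"
  obtains A :: "nat \<Rightarrow> nat \<Rightarrow> real" where "\<And>n i. A n i > 0"
    "\<And>n i. A n i * A n (i + 2) \<le> (A n (i + 1))\<^sup>2" "\<And>i. (\<lambda>n. A n i) \<longlonglongrightarrow> a i"
proof (cases "\<forall>i. a i = 0")
  case True
  show ?thesis
    by (rule that[of "\<lambda>n i. inverse (real (Suc n))"])
      (use True LIMSEQ_inverse_real_of_nat in \<open>simp_all add: power2_eq_square\<close>)
next
  case False
  define p where "p = (LEAST i. a i \<noteq> 0)"
  define q where "q = (GREATEST i. a i \<noteq> 0)"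
  from False obtain i0 where i0: "a i0 \<noteq> 0" by blast
  have bd: "a i \<noteq> 0 \<Longrightarrow> i \<le> d" for i using fin by (meson not_le)
  have p0: "a p \<noteq> 0" unfolding p_def by (rule LeastI[of "\<lambda>i. a i \<noteq> 0", OF i0])
  have q0: "a q \<noteq> 0" unfolding q_def by (rule GreatestI_nat[of "\<lambda>i. a i \<noteq> 0", OF i0 bd])
  have pl: "p \<le> i" if "a i \<noteq> 0" for i unfolding p_def by (rule Least_le[of "\<lambda>i. a i \<noteq> 0", OF that])
  have qg: "i \<le> q" if "a i \<noteq> 0" for i unfolding q_def by (rule Greatest_le_nat[of "\<lambda>i. a i \<noteq> 0", OF that bd])
  have pq: "p \<le> q" using pl q0 by blast
  have pos: "a i > 0" if "p \<le> i" "i \<le> q" for i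
  proof -
    have "i = p \<or> i = q \<or> p < i \<and> i < q" using that by linarith
    hence "a i \<noteq> 0" using niz[of p i q] p0 q0 by blast
    thus ?thesis using nn[of i] by simp
  qed
  \<comment> \<open>The bound on the ratio keeps log-concavity at \<open>p\<close> and at
    \<open>q\<close>; the added 1 avoids a zero denominator, and the bound 1 serves the case
    \<open>p = q\<close>, where both tails meet one entry.\<close>
  define c where "c = min 1 (min (a p / (1 + a (p + 1))) (a q / (1 + a (q - 1))))"
  have c: "c > 0" "c \<le> 1" "c \<le> a p / (1 + a (p + 1))" "c \<le> a q / (1 + a (q - 1))"
    using pos[of p] pos[of q] pq nn[of "p + 1"] nn[of "q - 1"] by (auto simp: c_def)
  define \<delta> where "\<delta> n = c * inverse (real (Suc n))" for n
  have \<delta>: "\<delta> n > 0" "\<delta> n \<le> c" for n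
  proof -
    show "\<delta> n > 0" using c by (simp add: \<delta>_def)
    have "c * inverse (real (Suc n)) \<le> c * 1" using c by (intro mult_left_mono) (auto simp: field_simps)
    thus "\<delta> n \<le> c" by (simp add: \<delta>_def)
  qed
  have \<delta>p: "\<delta> n * a (p + 1) \<le> a p" for n
  proof -
    have "\<delta> n * (1 + a (p + 1)) \<le> a p"
      using order_trans[OF \<delta>(2) c(3), of n] nn[of "p + 1"] by (simp add: pos_le_divide_eq)
    thus ?thesis using \<delta>(1)[of n] by (simp add: algebra_simps)
  qed
  have \<delta>q: "\<delta> n * a (q - 1) \<le> a q" for n
  proof -
    have "\<delta> n * (1 + a (q - 1)) \<le> a q"
      using order_trans[OF \<delta>(2) c(4), of n] nn[of "q - 1"] by (simp add: pos_le_divide_eq)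
    thus ?thesis using \<delta>(1)[of n] by (simp add: algebra_simps)
  qed
  have \<delta>1: "\<delta> n \<le> 1" for n using \<delta>(2)[of n] c by simp
  have lim: "\<delta> \<longlonglongrightarrow> 0"
    unfolding \<delta>_def using tendsto_mult_left[OF LIMSEQ_inverse_real_of_nat, of c] by simp
  define A where "A n i = (if i < p then a p * \<delta> n ^ (p - i) else if q < i then a q * \<delta> n ^ (i - q) else a i)" for n i
  show ?thesis
  proof (rule that[of A])
    fix n i
    show "A n i > 0" using pos \<delta> pq by (auto simp: A_def)
    consider "i + 2 \<le> p" | "i + 1 = p" "p < q" | "i + 1 = p" "p = q" | "p \<le> i" "i + 2 \<le> q"
      | "p \<le> i" "i + 1 = q" | "q \<le> i"
      using pq by linarith
    thus "A n i * A n (i + 2) \<le> (A n (i + 1))\<^sup>2"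
    proof cases
      case 1
      then obtain l where l: "p = i + 2 + l" using le_Suc_ex by blast
      have "A n i = a p * \<delta> n ^ (l + 2)" "A n (i + 1) = a p * \<delta> n ^ (l + 1)" "A n (i + 2) = a p * \<delta> n ^ l"
        using pq by (auto simp: A_def l)
      thus ?thesis by (simp add: power2_eq_square power_add algebra_simps)
    next
      case 2
      hence "A n i = a p * \<delta> n" "A n (i + 1) = a p" "A n (i + 2) = a (p + 1)"
        by (auto simp: A_def numeral_eq_Suc)
      thus ?thesis using mult_left_mono[OF \<delta>p[of n] nn[of p]] by (simp add: power2_eq_square mult_ac)
    next
      case 3
      hence e: "A n i = a p * \<delta> n" "A n (i + 1) = a p" "A n (i + 2) = a p * \<delta> n"
        by (auto simp: A_def)
      have "\<delta> n * \<delta> n \<le> 1" using \<delta>(1)[of n] \<delta>1[of n] by (simp add: mult_le_one)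
      from mult_left_mono[OF this zero_le_power2[of "a p"]] show ?thesis
        unfolding e by (simp add: power2_eq_square mult_ac)
    next
      case 4
      thus ?thesis using lc[of i] by (simp add: A_def)
    next
      case 5
      hence "A n i = a (q - 1)" "A n (i + 1) = a q" "A n (i + 2) = a q * \<delta> n"
        by (auto simp: A_def)
      thus ?thesis using mult_left_mono[OF \<delta>q[of n] nn[of q]] by (simp add: power2_eq_square mult_ac)
    next
      case 6
      then obtain l where l: "i = q + l" using le_Suc_ex by blast
      have "A n i = a q * \<delta> n ^ l" "A n (i + 1) = a q * \<delta> n ^ (l + 1)" "A n (i + 2) = a q * \<delta> n ^ (l + 2)"
        using pq by (auto simp: A_def l)
      thus ?thesis by (simp add: power2_eq_square power_add algebra_simps)
    qed
  next
    fix i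
    have z: "(\<lambda>n. b * \<delta> n ^ k) \<longlonglongrightarrow> 0" if "k > 0" for b k
      using tendsto_mult_left[OF tendsto_power[OF lim, of k], of b] that by (simp add: power_0_left)
    consider "i < p" | "q < i" | "p \<le> i" "i \<le> q" by linarith
    thus "(\<lambda>n. A n i) \<longlonglongrightarrow> a i"
    proof cases
      case 1
      hence "a i = 0" using pl[of i] by (meson not_le)
      thus ?thesis using 1 z[of "p - i" "a p"] by (simp add: A_def)
    next
      case 2
      hence "a i = 0" using qg[of i] by (meson not_le)
      thus ?thesis using 2 pq z[of "i - q" "a q"] by (simp add: A_def)
    next
      case 3
      thus ?thesis by (simp add: A_def)
    qed
  qed
qed

lemma tendsto_pascal:
  assumes "\<And>i. (\<lambda>n. A n i) \<longlonglongrightarrow> a i"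
  shows "(\<lambda>n. pascal (A n) l i) \<longlonglongrightarrow> pascal a l i"
  by (induction l arbitrary: i) (auto intro!: tendsto_add assms)

lemma tendsto_pair_tensor:
  assumes "\<And>i. (\<lambda>n. A n i) \<longlonglongrightarrow> a i" "\<And>i. (\<lambda>n. B n i) \<longlonglongrightarrow> b i"
  shows "(\<lambda>n. pair_tensor d (A n) e (B n) M) \<longlonglongrightarrow> pair_tensor d a e b M"
proof -
  have "(\<lambda>n. q_tensor d (A n) r s t) \<longlonglongrightarrow> q_tensor d a r s t" for r s t
  proof (cases "r \<le> d \<and> s \<le> d \<and> t \<le> d \<and> r + s + t = 2 * d")
    case True
    hence q: "q_tensor d x r s t = fact r * fact s * fact t / (fact (d - r) * fact (d - s) * fact (d - t)) *
        pascal x (d - r) (d - t)" for x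
      by (simp add: q_tensor_def)
    show ?thesis unfolding q by (intro tendsto_mult_left tendsto_pascal assms)
  next
    case False
    thus ?thesis by (auto simp: q_tensor_def)
  qed
  thus ?thesis unfolding pair_tensor_def by (intro tendsto_mult) (auto intro: assms)
qed

lemma tendsto_contract_funpow:
  assumes "\<And>M. (\<lambda>n. f n M) \<longlonglongrightarrow> g M" "\<And>i. (\<lambda>n. v n i) \<longlonglongrightarrow> u i"
  shows "(\<lambda>n. (contract (v n) ^^ l) (f n) M) \<longlonglongrightarrow> (contract u ^^ l) g M"
proof (induction l arbitrary: M)
  case (Suc l)
  have step: "(contract x ^^ Suc l) h M = (\<Sum>i\<in>UNIV. x i * (contract x ^^ l) h (add_mset i M))" for x h
    by (simp add: contract_def)
  show ?case unfolding step by (intro tendsto_sum tendsto_mult assms Suc)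
qed (simp add: assms)

text \<open>Sequences and directions are perturbed together to be strictly positive; the inequality
  between consecutive contractions then passes to the limit.\<close>

lemma hadamard_sum_log_concave:
  fixes a b :: "nat \<Rightarrow> real"
  assumes a: "\<And>i. a i \<ge> 0" "\<And>i. a i * a (i + 2) \<le> (a (i + 1))\<^sup>2"
      "\<And>i j k. i < j \<Longrightarrow> j < k \<Longrightarrow> a i \<noteq> 0 \<Longrightarrow> a k \<noteq> 0 \<Longrightarrow> a j \<noteq> 0" "\<And>i. i > d \<Longrightarrow> a i = 0"
    and b: "\<And>i. b i \<ge> 0" "\<And>i. b i * b (i + 2) \<le> (b (i + 1))\<^sup>2"
      "\<And>i j k. i < j \<Longrightarrow> j < k \<Longrightarrow> b i \<noteq> 0 \<Longrightarrow> b k \<noteq> 0 \<Longrightarrow> b j \<noteq> 0" "\<And>i. i > e \<Longrightarrow> b i = 0"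
    and k: "0 < k" "k < d + e"
  defines "w \<equiv> \<lambda>k. (\<Sum>i\<le>d. \<Sum>j\<le>e. (real (d choose i) * a i) * (real (e choose j) * b j) * real (hadamard_coeff d i e j k))"
  defines "v \<equiv> \<lambda>k. w k / real ((d + e) choose k)"
  shows "v (k - 1) * v (k + 1) \<le> (v k)\<^sup>2"
proof -
  define m where "m = d + e"
  obtain A where A: "\<And>n i. A n i > 0" "\<And>n i. A n i * A n (i + 2) \<le> (A n (i + 1))\<^sup>2"
    "\<And>i. (\<lambda>n. A n i) \<longlonglongrightarrow> a i"
    using positive_log_concave_approximation[of a d] a by blast
  obtain B where B: "\<And>n i. B n i > 0" "\<And>n i. B n i * B n (i + 2) \<le> (B n (i + 1))\<^sup>2"
    "\<And>i. (\<lambda>n. B n i) \<longlonglongrightarrow> b i"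
    using positive_log_concave_approximation[of b e] b by blast
  define pert where "pert x n i = x i + inverse (real (Suc n))" for x :: "idx \<Rightarrow> real" and n i
  have pert_pos: "pert x n i > 0" if "x i \<ge> 0" for x n i
    using that by (simp add: pert_def add_nonneg_pos)
  have pert_lim: "(\<lambda>n. pert x n i) \<longlonglongrightarrow> x i" for x i
    unfolding pert_def using tendsto_add[OF tendsto_const LIMSEQ_inverse_real_of_nat, of "x i"] by simp
  have vnn: "vr i \<ge> 0" "vs i \<ge> 0" "vt i \<ge> 0" for i
    by (simp_all add: vr_def vs_def vt_def split: idx.split)
  define Z where "Z n x y = (contract (pert vr n) ^^ d) ((contract (pert vs n) ^^ x)
      ((contract (pert vt n) ^^ y) (pair_tensor d (A n) e (B n)))) {#}" for n x y
  \<comment> \<open>The factorials from differentiation match the binomial normalisation of ultra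
    log-concavity: up to a factor independent of \<open>x\<close>, the limit is
    \<open>v x\<close>.\<close>
  have lim: "(\<lambda>n. Z n x (m - x)) \<longlonglongrightarrow> fact m / fact e * v x" if "x \<le> m" for x
  proof -
    have "(\<lambda>n. Z n x (m - x)) \<longlonglongrightarrow>
        (contract vr ^^ d) ((contract vs ^^ x) ((contract vt ^^ (m - x)) (pair_tensor d a e b))) {#}"
      unfolding Z_def
      by (intro tendsto_contract_funpow pert_lim tendsto_pair_tensor A B)
    also have "(contract vr ^^ d) ((contract vs ^^ x) ((contract vt ^^ (m - x)) (pair_tensor d a e b))) {#} =
        fact x * fact (m - x) / fact e * w x"
      unfolding m_def w_def using that by (intro contract_pair_tensor_value) (simp add: m_def)
    also have "\<dots> = fact m / fact e * v x"
      using that unfolding v_def m_def[symmetric] by (simp add: binomial_fact)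
    finally show ?thesis .
  qed
  \<comment> \<open>Exponents chosen so that, after \<open>d\<close> contractions along r, two slots
    remain.\<close>
  define x y where "x = k - 1" and "y = m - k - 1"
  have xy: "k = x + 1" "m = x + y + 2" using k by (simp_all add: x_def y_def m_def)
  have "Z n (x + 2) y * Z n x (y + 2) \<le> (Z n (x + 1) (y + 1))\<^sup>2" for n
    unfolding Z_def
  proof (rule connected_support.contract_log_concave[OF connected_support_pair])
    show "lorentzian_tensor (pair_support d e) (2 * d + e) (pair_tensor d (A n) e (B n))"
      by (intro lorentzian_tensor_pair A B)
    show "2 * d + e = d + x + y + 2" using xy by (simp add: m_def)
  qed (auto intro: pert_pos vnn)
  hence "Z n (k + 1) (m - (k + 1)) * Z n (k - 1) (m - (k - 1)) \<le> (Z n k (m - k))\<^sup>2" for n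
    using xy by (simp add: numeral_eq_Suc)
  moreover have "(\<lambda>n. Z n (k + 1) (m - (k + 1)) * Z n (k - 1) (m - (k - 1))) \<longlonglongrightarrow>
      (fact m / fact e * v (k + 1)) * (fact m / fact e * v (k - 1))"
    using k by (intro tendsto_mult lim) (auto simp: m_def)
  moreover have "(\<lambda>n. (Z n k (m - k))\<^sup>2) \<longlonglongrightarrow> (fact m / fact e * v k)\<^sup>2"
    using k by (intro tendsto_power lim) (auto simp: m_def)
  ultimately have "(fact m / fact e * v (k + 1)) * (fact m / fact e * v (k - 1)) \<le> (fact m / fact e * v k)\<^sup>2"
    by (intro LIMSEQ_le) auto
  hence "(fact m / fact e)\<^sup>2 * (v (k - 1) * v (k + 1)) \<le> (fact m / fact e)\<^sup>2 * (v k)\<^sup>2"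
    by (simp add: power_mult_distrib power2_eq_square mult_ac)
  thus ?thesis by (simp add: mult_le_cancel_left)
qed

text \<open>Membership constrains only indices inside the degree; past it a factor of the product is
  0. For \<open>i > m\<close> the quotient is 0 along with its denominator.\<close>

lemma ULC_normalized:
  assumes "w \<in> ULC m"
  defines "a \<equiv> \<lambda>i. coeff w i / real (m choose i)"
  shows "a i \<ge> 0" "a i * a (i + 2) \<le> (a (i + 1))\<^sup>2"
    "i < j \<Longrightarrow> j < k \<Longrightarrow> a i \<noteq> 0 \<Longrightarrow> a k \<noteq> 0 \<Longrightarrow> a j \<noteq> 0" "i > m \<Longrightarrow> a i = 0"
    "i \<le> m \<Longrightarrow> real (m choose i) * a i = coeff w i"
proof -
  have w: "coeff w j \<ge> 0" "degree w \<le> m" "no_internal_zeros w" for j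
    using assms(1) by (auto simp: ULC_def)
  have lc: "log_concave_upto (degree w) a" using assms(1) by (simp add: ULC_def a_def)
  show "a i \<ge> 0" using w by (simp add: a_def)
  show "a i * a (i + 2) \<le> (a (i + 1))\<^sup>2"
  proof (cases "i + 1 < degree w")
    case True
    thus ?thesis using lc[unfolded log_concave_upto_def, rule_format, of "i + 1"] by simp
  next
    case False
    hence "a (i + 2) = 0" by (simp add: a_def coeff_eq_0)
    thus ?thesis by simp
  qed
  have nz: "a l \<noteq> 0 \<longleftrightarrow> coeff w l \<noteq> 0" for l
    using w(2) by (cases "l \<le> m") (simp_all add: a_def coeff_eq_0)
  show "i < j \<Longrightarrow> j < k \<Longrightarrow> a i \<noteq> 0 \<Longrightarrow> a k \<noteq> 0 \<Longrightarrow> a j \<noteq> 0"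
    using w(3) unfolding nz no_internal_zeros_def by (metis mult_eq_0_iff)
  show "i > m \<Longrightarrow> a i = 0" by (simp add: a_def)
  show "i \<le> m \<Longrightarrow> real (m choose i) * a i = coeff w i" by (simp add: a_def)
qed

text \<open>With nonnegative terms nothing cancels, so the coefficient at \<open>k\<close> is
  nonzero exactly when some admissible \<open>i\<close> and \<open>j\<close> make both binomials
  nonzero. These conditions decouple: the support of \<open>f\<close> must meet [k - e, k] and that
  of \<open>g\<close> must meet [k - d, k].\<close>

lemma no_internal_zeros_W_poly_mult:
  assumes nz: "p \<noteq> 0" "q \<noteq> 0"
    and nn: "\<And>i. coeff (W_poly p) i \<ge> 0" "\<And>i. coeff (W_poly q) i \<ge> 0"
    and niz: "no_internal_zeros (W_poly p)" "no_internal_zeros (W_poly q)"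
  shows "no_internal_zeros (W_poly (p * q))"
proof -
  define d e where "d = degree p" and "e = degree q"
  define f g where "f = coeff (W_poly p)" and "g = coeff (W_poly q)"
  have f0: "f i \<noteq> 0 \<Longrightarrow> i \<le> d" and g0: "g i \<noteq> 0 \<Longrightarrow> i \<le> e" for i
    using degree_W_poly_le[of p] degree_W_poly_le[of q] le_degree order_trans
    unfolding f_def g_def d_def e_def by blast+
  \<comment> \<open>If a window lying between two support points contains neither of them, its right
    end \<open>y\<close> is strictly between them and hence in the support.\<close>
  have interval: "\<exists>l. c l \<noteq> 0 \<and> l \<le> y \<and> y \<le> l + n"
    if "\<And>i j k. i < j \<Longrightarrow> j < k \<Longrightarrow> c i \<noteq> 0 \<Longrightarrow> c k \<noteq> 0 \<Longrightarrow> c j \<noteq> 0"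
      "c i \<noteq> 0" "i \<le> y" "c i' \<noteq> 0" "y \<le> i' + n" for c :: "nat \<Rightarrow> real" and i i' y n :: nat
  proof -
    consider "y \<le> i + n" | "i' \<le> y" | "i < y" "y < i'" using that by linarith
    thus ?thesis
    proof cases
      case 3
      hence "c y \<noteq> 0" using that by blast
      thus ?thesis by (intro exI[of _ y]) simp
    qed (use that in blast)+
  qed
  have pos: "coeff (W_poly (p * q)) k \<noteq> 0 \<longleftrightarrow>
      (\<exists>i j. f i \<noteq> 0 \<and> g j \<noteq> 0 \<and> i \<le> k \<and> j \<le> k \<and> k \<le> d + j \<and> k \<le> e + i)" for k
  proof -
    have h: "hadamard_coeff d i e j k \<noteq> 0 \<longleftrightarrow> i \<le> k \<and> j \<le> k \<and> k \<le> d + j \<and> k \<le> e + i"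
      if "i \<le> d" "j \<le> e" for i j
      using that by (auto simp: hadamard_coeff_def)
    define t where "t i j = f i * g j * real (hadamard_coeff d i e j k)" for i j
    have t: "t i j \<ge> 0" for i j using nn by (simp add: t_def f_def g_def)
    have "coeff (W_poly (p * q)) k = (\<Sum>i\<le>d. \<Sum>j\<le>e. t i j)"
      by (simp only: coeff_W_poly_mult[OF nz] d_def e_def f_def g_def t_def)
    also have "\<dots> = 0 \<longleftrightarrow> (\<forall>i\<le>d. \<forall>j\<le>e. t i j = 0)"
      by (auto simp: sum_nonneg_eq_0_iff sum_nonneg t)
    finally have "coeff (W_poly (p * q)) k \<noteq> 0 \<longleftrightarrow> (\<exists>i j. i \<le> d \<and> j \<le> e \<and> t i j \<noteq> 0)" by blast
    also have "\<dots> \<longleftrightarrow> (\<exists>i j. f i \<noteq> 0 \<and> g j \<noteq> 0 \<and> i \<le> k \<and> j \<le> k \<and> k \<le> d + j \<and> k \<le> e + i)"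
    proof -
      have "i \<le> d \<and> j \<le> e \<and> t i j \<noteq> 0 \<longleftrightarrow>
          f i \<noteq> 0 \<and> g j \<noteq> 0 \<and> i \<le> k \<and> j \<le> k \<and> k \<le> d + j \<and> k \<le> e + i" for i j
        using h[of i j] f0[of i] g0[of j] by (auto simp: t_def)
      thus ?thesis by simp
    qed
    finally show ?thesis .
  qed
  show ?thesis unfolding no_internal_zeros_def
  proof (intro notI, elim exE conjE)
    fix x y z assume xyz: "x < y" "y < z" and y: "coeff (W_poly (p * q)) y = 0"
      and xz: "coeff (W_poly (p * q)) x * coeff (W_poly (p * q)) z \<noteq> 0"
    from xz pos obtain i j where ij: "f i \<noteq> 0" "g j \<noteq> 0" "i \<le> x" "j \<le> x" by auto
    from xz pos obtain i' j' where ij': "f i' \<noteq> 0" "g j' \<noteq> 0" "z \<le> d + j'" "z \<le> e + i'" by auto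
    have "\<exists>l. f l \<noteq> 0 \<and> l \<le> y \<and> y \<le> l + e"
      by (rule interval[of f i y i'])
        (use niz(1) ij ij' xyz in \<open>auto simp: no_internal_zeros_def f_def\<close>)
    moreover have "\<exists>l. g l \<noteq> 0 \<and> l \<le> y \<and> y \<le> l + d"
      by (rule interval[of g j y j'])
        (use niz(2) ij ij' xyz in \<open>auto simp: no_internal_zeros_def g_def\<close>)
    ultimately show False using y pos[of y] by (auto simp: add.commute)
  qed
qed

theorem theorem1p2:
  fixes p\<^sub>1 p\<^sub>2 :: "real poly"
  assumes "p\<^sub>1 \<noteq> 0" and "p\<^sub>2 \<noteq> 0"
    and "W_poly p\<^sub>1 \<in> ULC (degree p\<^sub>1)"
    and "W_poly p\<^sub>2 \<in> ULC (degree p\<^sub>2)"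
  shows "W_poly (p\<^sub>1 * p\<^sub>2) \<in> ULC (degree p\<^sub>1 + degree p\<^sub>2)"
proof -
  define d e where "d = degree p\<^sub>1" and "e = degree p\<^sub>2"
  define a where "a i = coeff (W_poly p\<^sub>1) i / real (d choose i)" for i
  define b where "b i = coeff (W_poly p\<^sub>2) i / real (e choose i)" for i
  note a = ULC_normalized[OF assms(3), folded d_def, folded a_def]
  note b = ULC_normalized[OF assms(4), folded e_def, folded b_def]
  have nn: "coeff (W_poly p\<^sub>1) i \<ge> 0" "coeff (W_poly p\<^sub>2) i \<ge> 0" for i
    using assms(3,4) by (auto simp: ULC_def)
  have w: "coeff (W_poly (p\<^sub>1 * p\<^sub>2)) k =
      (\<Sum>i\<le>d. \<Sum>j\<le>e. (real (d choose i) * a i) * (real (e choose j) * b j) * real (hadamard_coeff d i e j k))" for k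
    unfolding coeff_W_poly_mult[OF assms(1,2)] d_def[symmetric] e_def[symmetric]
    by (intro sum.cong refl) (simp add: a(5) b(5))
  have deg: "degree (W_poly (p\<^sub>1 * p\<^sub>2)) \<le> d + e"
    using degree_W_poly_le[of "p\<^sub>1 * p\<^sub>2"] assms(1,2) by (simp add: degree_mult_eq d_def e_def)
  have "coeff (W_poly (p\<^sub>1 * p\<^sub>2)) k \<ge> 0" for k
    unfolding coeff_W_poly_mult[OF assms(1,2)] using nn by (intro sum_nonneg) simp
  moreover have "log_concave_upto (degree (W_poly (p\<^sub>1 * p\<^sub>2)))
      (\<lambda>k. coeff (W_poly (p\<^sub>1 * p\<^sub>2)) k / real ((d + e) choose k))"
    unfolding log_concave_upto_def
  proof (intro allI impI)
    fix k assume "0 < k \<and> k < degree (W_poly (p\<^sub>1 * p\<^sub>2))"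
    hence k: "0 < k" "k < d + e" using deg by auto
    show "coeff (W_poly (p\<^sub>1 * p\<^sub>2)) (k - 1) / real ((d + e) choose (k - 1)) *
        (coeff (W_poly (p\<^sub>1 * p\<^sub>2)) (k + 1) / real ((d + e) choose (k + 1)))
        \<le> (coeff (W_poly (p\<^sub>1 * p\<^sub>2)) k / real ((d + e) choose k))\<^sup>2"
      unfolding w by (rule hadamard_sum_log_concave[of a d b e k, OF a(1-4) b(1-4) k])
  qed
  moreover have "no_internal_zeros (W_poly (p\<^sub>1 * p\<^sub>2))"
    using assms nn by (intro no_internal_zeros_W_poly_mult) (auto simp: ULC_def)
  ultimately show ?thesis using deg by (simp add: ULC_def d_def e_def)
qed

end
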